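(* The problem \textsc{Boxicity} is fixed-parameter tractable when parameterized by the cluster vertex deletion number of the input graph; that is, there is a computable function $f$ and an algorithm that, given a graph $G$ and an integer $d$, decides whether $\mathrm{box}(G)\le d$ in time $f(k)\cdot n^{O(1)}$, where $n=|V(G)|$ and $k$ is the cluster vertex deletion number of $G$.
   Context: A $d$-box is a Cartesian product of $d$ closed real intervals. A $d$-box representation of a graph $G$ assigns to each vertex $v$ a $d$-box $B_v$ such that distinct vertices $u,v$ are adjacent iff $B_u\cap B_v\neq\emptyset$. The boxicity $\mathrm{box}(G)$ is the least $d$ such that $G$ has a $d$-box representation. \textsc{Boxicity}: given a graph $G$ and an integer $d$, decide whether $\mathrm{box}(G)\le d$. A cluster graph is a disjoint union of complete graphs. The cluster vertex deletion number of $G$ is the minimum number of vertices whose deletion from $G$ yields a cluster graph. *)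

theory Defs
  imports
    Complex_Main
    "HOL-Library.FuncSet"
    "HOL-Library.Disjoint_Sets"
    "Graph_Theory.Digraph_Component"
begin

section \<open>Boxicity\<close>

text \<open>The case \<open>d = 0\<close> is allowed: the only 0-box is the one-point set, so
  complete graphs have boxicity 0.\<close>

definition is_box :: "nat \<Rightarrow> (nat \<Rightarrow> real) set \<Rightarrow> bool" where
  "is_box d B \<longleftrightarrow>
     (\<exists>l u. (\<forall>i<d. l i \<le> u i) \<and> B = (\<Pi>\<^sub>E i\<in>{..<d}. {l i..u i}))"

definition box_representation ::
    "('a, 'b) pre_digraph \<Rightarrow> nat \<Rightarrow> ('a \<Rightarrow> (nat \<Rightarrow> real) set) \<Rightarrow> bool" where
  "box_representation G d B \<longleftrightarrow>
     (\<forall>v\<in>verts G. is_box d (B v)) \<and>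
     (\<forall>u\<in>verts G. \<forall>v\<in>verts G. u \<noteq> v \<longrightarrow> (u \<rightarrow>\<^bsub>G\<^esub> v \<longleftrightarrow> B u \<inter> B v \<noteq> {}))"

definition boxicity :: "('a, 'b) pre_digraph \<Rightarrow> nat" where
  "boxicity G = (LEAST d. \<exists>B. box_representation G d B)"


section \<open>Cluster vertex deletion number\<close>

definition cluster_graph :: "('a, 'b) pre_digraph \<Rightarrow> bool" where
  "cluster_graph G \<longleftrightarrow> graph G \<and>
     (\<exists>P. partition_on (verts G) P \<and>
          arcs_ends G = (\<Union>C\<in>P. {(u, v). u \<in> C \<and> v \<in> C \<and> u \<noteq> v}))"

definition cluster_vertex_deletion_number :: "('a, 'b) pre_digraph \<Rightarrow> nat" where
  "cluster_vertex_deletion_number G =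
     (LEAST k. \<exists>S\<subseteq>verts G. card S = k \<and> cluster_graph (G \<restriction> (verts G - S)))"


section \<open>Random access machines\<close>

text \<open>
  Random access machines with the uniform cost measure. Registers are indexed by, and contain,
  natural numbers; the arithmetic instructions are addition, truncated subtraction and halving.
  There is no multiplication, so numbers grow by at most one bit per step and running times are
  polynomially related to those of Turing machines. All registers are initially 0. The input is a
  list of numbers in a separate read-only memory with random access; a machine halts when the
  program counter leaves the program, and its output is the content of register 0.
\<close>

datatype instr =
    Const nat nat      (* R i := c *)
  | Copy nat nat       (* R i := R j *)
  | Add nat nat nat    (* R i := R j + R k *)
  | Sub nat nat nat    (* R i := R j - R k *)
  | Half nat nat       (* R i := R j div 2 *)
  | Load nat nat       (* R i := R (R j) *)
  | Store nat nat      (* R (R i) := R j *)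
  | Read nat nat       (* R i := input (R j) *)
  | Jump nat
  | Jzero nat nat      (* jump to l if R i = 0 *)

type_synonym config = "nat \<times> (nat \<Rightarrow> nat)"

fun exec :: "nat list \<Rightarrow> instr \<Rightarrow> config \<Rightarrow> config" where
  "exec xs (Const i c) (pc, R) = (Suc pc, R(i := c))"
| "exec xs (Copy i j) (pc, R) = (Suc pc, R(i := R j))"
| "exec xs (Add i j k) (pc, R) = (Suc pc, R(i := R j + R k))"
| "exec xs (Sub i j k) (pc, R) = (Suc pc, R(i := R j - R k))"
| "exec xs (Half i j) (pc, R) = (Suc pc, R(i := R j div 2))"
| "exec xs (Load i j) (pc, R) = (Suc pc, R(i := R (R j)))"
| "exec xs (Store i j) (pc, R) = (Suc pc, R(R i := R j))"
| "exec xs (Read i j) (pc, R) =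
     (Suc pc, R(i := (if R j < length xs then xs ! R j else 0)))"
| "exec xs (Jump l) (pc, R) = (l, R)"
| "exec xs (Jzero i l) (pc, R) = (if R i = 0 then l else Suc pc, R)"

definition halted :: "instr list \<Rightarrow> config \<Rightarrow> bool" where
  "halted P c \<longleftrightarrow> length P \<le> fst c"

definition step :: "instr list \<Rightarrow> nat list \<Rightarrow> config \<Rightarrow> config" where
  "step P xs c = (if halted P c then c else exec xs (P ! fst c) c)"

definition run :: "instr list \<Rightarrow> nat list \<Rightarrow> nat \<Rightarrow> config" where
  "run P xs t = (step P xs ^^ t) (0, \<lambda>_. 0)"

definition outputs_within :: "instr list \<Rightarrow> nat list \<Rightarrow> nat \<Rightarrow> nat \<Rightarrow> bool" where
  "outputs_within P xs T y \<longleftrightarrow> (\<exists>t\<le>T. halted P (run P xs t) \<and> snd (run P xs t) 0 = y)"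

definition computable :: "(nat \<Rightarrow> nat) \<Rightarrow> bool" where
  "computable f \<longleftrightarrow> (\<exists>P. \<forall>k. \<exists>T. outputs_within P [k] T (f k))"


section \<open>Instances\<close>

text \<open>A graph with vertex set \<open>{0..<n}\<close> is given by its number of vertices and its
  adjacency matrix in row-major order; the integer \<open>d\<close> is given by sign and absolute value.\<close>

definition boxicity_instance :: "nat pair_pre_digraph \<Rightarrow> int \<Rightarrow> nat list" where
  "boxicity_instance G d =
     (let n = card (pverts G) in
       [n, of_bool (d < 0), nat \<bar>d\<bar>] @
       concat (map (\<lambda>u. map (\<lambda>v. of_bool ((u, v) \<in> parcs G)) [0..<n]) [0..<n]))"

end

theory Submission
  imports Defs
begin

text \<open>A maximal family of disjoint induced paths on three vertices covers a set \<open>S\<close> of at most \<open>3 k\<close>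
  vertices whose removal leaves a cluster graph. Since \<open>G\<close> has a box representation in
  \<open>|S| + 1\<close> dimensions, only \<open>d \<le> |S| + 1\<close> matters. True twins outside \<open>S\<close> can share a box. Call
  two clusters equivalent if the same subsets of \<open>S\<close> occur as neighbourhoods of their vertices. If a
  cluster has sufficiently many equivalent companions, then two of these lie in the same position
  relative to the boxes of \<open>S\<close>, and a further copy fits in next to one of them; so the cluster may
  be deleted. What remains has size bounded in terms of \<open>k\<close> and is solved by exhaustive search over
  integer endpoints.

  The algorithm is written in a small language of total programs with bounded loops. If all loops of
  a run make at most \<open>W\<close> iterations, the compiled program takes time polynomial in \<open>W\<close>, and here
  \<open>W\<close> can be taken as a function of \<open>k\<close> times \<open>n\<close>. The same language makes this function
  computable.\<close>

section \<open>Total programs for random access machines\<close>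

text \<open>Variables are numbered from the bottom of the environment. The body of \<open>Loop\<close> sees the counter
  and the accumulator, and the body of \<open>Bind\<close> the bound value, at the end of the environment;
  \<open>Last k\<close> discards all but the last \<open>k\<close> values and \<open>Init\<close> discards the last one.\<close>

datatype expr =
    Num nat
  | Var nat
  | Inp expr
  | Plus expr expr
  | Minus expr expr
  | Hlf expr
  | Cond expr expr expr
  | Bind expr expr
  | Last nat expr
  | Init expr
  | Loop expr expr expr

primrec eval :: "nat list \<Rightarrow> expr \<Rightarrow> nat list \<Rightarrow> nat" where
  "eval xs (Num c) env = c"
| "eval xs (Var i) env = (if i < length env then env ! i else 0)"
| "eval xs (Inp a) env = (let j = eval xs a env in if j < length xs then xs ! j else 0)"
| "eval xs (Plus a b) env = eval xs a env + eval xs b env"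
| "eval xs (Minus a b) env = eval xs a env - eval xs b env"
| "eval xs (Hlf a) env = eval xs a env div 2"
| "eval xs (Cond a b c) env = (if eval xs a env = 0 then eval xs c env else eval xs b env)"
| "eval xs (Bind a b) env = eval xs b (env @ [eval xs a env])"
| "eval xs (Last k a) env = eval xs a (drop (length env - k) env)"
| "eval xs (Init a) env = eval xs a (butlast env)"
| "eval xs (Loop a b c) env =
     fold (\<lambda>i r. eval xs c (env @ [i, r])) [0..<eval xs a env] (eval xs b env)"

primrec loops_bounded :: "nat \<Rightarrow> nat list \<Rightarrow> expr \<Rightarrow> nat list \<Rightarrow> bool" where
  "loops_bounded W xs (Num c) env = True"
| "loops_bounded W xs (Var i) env = True"
| "loops_bounded W xs (Inp a) env = loops_bounded W xs a env"
| "loops_bounded W xs (Plus a b) env = (loops_bounded W xs a env \<and> loops_bounded W xs b env)"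
| "loops_bounded W xs (Minus a b) env = (loops_bounded W xs a env \<and> loops_bounded W xs b env)"
| "loops_bounded W xs (Hlf a) env = loops_bounded W xs a env"
| "loops_bounded W xs (Cond a b c) env =
     (loops_bounded W xs a env \<and>
      (if eval xs a env = 0 then loops_bounded W xs c env else loops_bounded W xs b env))"
| "loops_bounded W xs (Bind a b) env =
     (loops_bounded W xs a env \<and> loops_bounded W xs b (env @ [eval xs a env]))"
| "loops_bounded W xs (Last k a) env = loops_bounded W xs a (drop (length env - k) env)"
| "loops_bounded W xs (Init a) env = loops_bounded W xs a (butlast env)"
| "loops_bounded W xs (Loop a b c) env =
     (loops_bounded W xs a env \<and> loops_bounded W xs b env \<and> eval xs a env \<le> W \<and>
      (\<forall>i<eval xs a env. loops_bounded W xs c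
         (env @ [i, fold (\<lambda>i r. eval xs c (env @ [i, r])) [0..<i] (eval xs b env)])))"

primrec cost :: "nat \<Rightarrow> expr \<Rightarrow> nat" where
  "cost W (Num c) = 1"
| "cost W (Var i) = 1"
| "cost W (Inp a) = cost W a + 1"
| "cost W (Plus a b) = cost W a + cost W b + 1"
| "cost W (Minus a b) = cost W a + cost W b + 1"
| "cost W (Hlf a) = cost W a + 1"
| "cost W (Cond a b c) = cost W a + cost W b + cost W c + 2"
| "cost W (Bind a b) = cost W a + cost W b + 1"
| "cost W (Last k a) = cost W a"
| "cost W (Init a) = cost W a"
| "cost W (Loop a b c) = cost W a + cost W b + W * (cost W c + 6) + 4"

text \<open>\<open>compile e q rs t\<close> is code to be placed at address \<open>q\<close>; it finds the environment in the
  registers \<open>rs\<close>, leaves the value in register \<open>t\<close> and only changes registers from \<open>t\<close> on. A loop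
  keeps its number of iterations, its accumulator and its counter in the registers \<open>t\<close>, \<open>t + 1\<close>
  and \<open>t + 2\<close>.\<close>

primrec compile :: "expr \<Rightarrow> nat \<Rightarrow> nat list \<Rightarrow> nat \<Rightarrow> instr list" where
  "compile (Num c) q rs t = [Const t c]"
| "compile (Var i) q rs t = [if i < length rs then Copy t (rs ! i) else Const t 0]"
| "compile (Inp a) q rs t = compile a q rs t @ [Read t t]"
| "compile (Plus a b) q rs t =
     (let ca = compile a q rs t; cb = compile b (q + length ca) rs (t + 1)
      in ca @ cb @ [Add t t (t + 1)])"
| "compile (Minus a b) q rs t =
     (let ca = compile a q rs t; cb = compile b (q + length ca) rs (t + 1)
      in ca @ cb @ [Sub t t (t + 1)])"
| "compile (Hlf a) q rs t = compile a q rs t @ [Half t t]"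
| "compile (Cond a b c) q rs t =
     (let ca = compile a q rs t;
          cb = compile b (q + length ca + 1) rs t;
          else_addr = q + length ca + length cb + 2;
          cc = compile c else_addr rs t
      in ca @ [Jzero t else_addr] @ cb @ [Jump (else_addr + length cc)] @ cc)"
| "compile (Bind a b) q rs t =
     (let ca = compile a q rs t; cb = compile b (q + length ca) (rs @ [t]) (t + 1)
      in ca @ cb @ [Copy t (t + 1)])"
| "compile (Last k a) q rs t = compile a q (drop (length rs - k) rs) t"
| "compile (Init a) q rs t = compile a q (butlast rs) t"
| "compile (Loop a b c) q rs t =
     (let ca = compile a q rs t;
          cb = compile b (q + length ca) rs (t + 1);
          start = q + length ca + length cb + 1;
          cc = compile c (start + 2) (rs @ [t + 2, t + 1]) (t + 3)
      in ca @ cb @ [Const (t + 2) 0] @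
         [Sub (t + 3) t (t + 2), Jzero (t + 3) (start + length cc + 6)] @ cc @
         [Copy (t + 1) (t + 3), Const (t + 3) 1, Add (t + 2) (t + 2) (t + 3), Jump start] @
         [Copy t (t + 1)])"

subsection \<open>Correctness of the compiler\<close>

primrec code_at :: "instr list \<Rightarrow> nat \<Rightarrow> instr list \<Rightarrow> bool" where
  "code_at P q [] \<longleftrightarrow> True"
| "code_at P q (i # is) \<longleftrightarrow> q < length P \<and> P ! q = i \<and> code_at P (Suc q) is"

lemma code_at_append [simp]:
  "code_at P q (is @ js) \<longleftrightarrow> code_at P q is \<and> code_at P (q + length is) js"
  by (induction "is" arbitrary: q) auto

lemma code_at_suffix: "code_at (P @ is) (length P) is"
proof (induction "is" arbitrary: P)
  case (Cons i "is")
  from Cons[of "P @ [i]"] show ?case by simp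
qed simp

definition stack :: "nat list \<Rightarrow> (nat \<Rightarrow> nat) \<Rightarrow> bool" where
  "stack st R \<longleftrightarrow> (\<forall>i<length st. R i = st ! i)"

lemma stack_Nil [simp]: "stack [] R"
  by (simp add: stack_def)

lemma all_less_add_iff: "(\<forall>i<m + k. Q i) \<longleftrightarrow> (\<forall>i<m. Q i) \<and> (\<forall>i<k. Q (m + i))" for m k :: nat
  by (induction k) (auto simp: less_Suc_eq)

lemma stack_append [simp]:
  "stack (st @ vs) R \<longleftrightarrow> stack st R \<and> (\<forall>i<length vs. R (length st + i) = vs ! i)"
  by (simp add: stack_def nth_append all_less_add_iff)

lemma stack_nth: "stack st R \<Longrightarrow> i < length st \<Longrightarrow> R i = st ! i"
  by (simp add: stack_def)

lemma stack_fun_upd [simp]: "length st \<le> r \<Longrightarrow> stack st (R(r := v)) \<longleftrightarrow> stack st R"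
  by (simp add: stack_def)

lemma map_nth_append:
  assumes "\<forall>r\<in>set rs. r < length st"
  shows "map ((!) (st @ vs)) rs = map ((!) st) rs"
  using assms by (simp add: nth_append)

definition runs :: "instr list \<Rightarrow> nat list \<Rightarrow> nat \<Rightarrow> nat \<Rightarrow> nat list \<Rightarrow> nat \<Rightarrow> nat list \<Rightarrow> bool" where
  "runs P xs T q st q' st' \<longleftrightarrow>
     (\<forall>R. stack st R \<longrightarrow> (\<exists>t\<le>T. \<exists>R'. (step P xs ^^ t) (q, R) = (q', R') \<and> stack st' R'))"

lemma runs_instr:
  assumes "code_at P q [i]"
    and "\<And>R. stack st R \<Longrightarrow> fst (exec xs i (q, R)) = q' \<and> stack st' (snd (exec xs i (q, R)))"
  shows "runs P xs 1 q st q' st'"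
  unfolding runs_def
proof (intro allI impI)
  fix R assume "stack st R"
  have "(step P xs ^^ 1) (q, R) = exec xs i (q, R)"
    using assms(1) by (simp add: step_def halted_def)
  with assms(2)[OF \<open>stack st R\<close>]
  show "\<exists>t\<le>1. \<exists>R'. (step P xs ^^ t) (q, R) = (q', R') \<and> stack st' R'"
    by (metis order.refl prod.collapse)
qed

lemma runs_seq [trans]:
  assumes "runs P xs T q st q' st'" "runs P xs T' q' st' q'' st''"
  shows "runs P xs (T + T') q st q'' st''"
  unfolding runs_def
proof (intro allI impI)
  fix R assume "stack st R"
  with assms(1) obtain t R' where
    first: "t \<le> T" "(step P xs ^^ t) (q, R) = (q', R')" "stack st' R'"
    unfolding runs_def by blast
  with assms(2) obtain t' R'' where
    second: "t' \<le> T'" "(step P xs ^^ t') (q', R') = (q'', R'')" "stack st'' R''"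
    unfolding runs_def by blast
  have "(step P xs ^^ (t' + t)) (q, R) = (q'', R'')" "t' + t \<le> T + T'"
    using first second by (simp_all add: funpow_add)
  with second(3) show "\<exists>t\<le>T + T'. \<exists>R''. (step P xs ^^ t) (q, R) = (q'', R'') \<and> stack st'' R''"
    by blast
qed

lemma runs_mono: "runs P xs T q st q' st' \<Longrightarrow> T \<le> T' \<Longrightarrow> runs P xs T' q st q' st'"
  unfolding runs_def using le_trans by blast

lemma runs_refl: "runs P xs 0 q st q st"
  unfolding runs_def by simp

lemma runs_iterate:
  assumes "\<And>i. i < n \<Longrightarrow> runs P xs T q (st i) q (st (Suc i))"
  shows "runs P xs (n * T) q (st 0) q (st n)"
  using assms
proof (induction n)
  case 0
  then show ?case using runs_refl by simp
next
  case (Suc n)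
  then have "runs P xs (n * T) q (st 0) q (st n)" by simp
  also have "runs P xs T q (st n) q (st (Suc n))" using Suc.prems by simp
  finally show ?case by (simp add: add.commute)
qed

definition compiles :: "instr list \<Rightarrow> nat list \<Rightarrow> nat \<Rightarrow> expr \<Rightarrow> bool" where
  "compiles P xs W e \<longleftrightarrow>
     (\<forall>q rs st. code_at P q (compile e q rs (length st)) \<longrightarrow> (\<forall>r\<in>set rs. r < length st) \<longrightarrow>
        loops_bounded W xs e (map ((!) st) rs) \<longrightarrow>
        runs P xs (cost W e) q st (q + length (compile e q rs (length st)))
          (st @ [eval xs e (map ((!) st) rs)]))"

lemma compilesI:
  assumes "\<And>q rs st. code_at P q (compile e q rs (length st)) \<Longrightarrow> \<forall>r\<in>set rs. r < length st \<Longrightarrow>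
    loops_bounded W xs e (map ((!) st) rs) \<Longrightarrow>
    runs P xs (cost W e) q st (q + length (compile e q rs (length st)))
      (st @ [eval xs e (map ((!) st) rs)])"
  shows "compiles P xs W e"
  unfolding compiles_def using assms by blast

lemma compilesD:
  assumes "compiles P xs W e" "t = length st" "code_at P q (compile e q rs t)"
    and "\<forall>r\<in>set rs. r < length st" "loops_bounded W xs e env" "env = map ((!) st) rs"
    and "q' = q + length (compile e q rs t)"
  shows "runs P xs (cost W e) q st q' (st @ [eval xs e env])"
  using assms unfolding compiles_def by blast

lemma compiles_Num: "compiles P xs W (Num c)"
proof (rule compilesI)
  fix q and rs st :: "nat list"
  assume "code_at P q (compile (Num c) q rs (length st))"
  then have "code_at P q [Const (length st) c]" by simp
  then have "runs P xs 1 q st (Suc q) (st @ [c])" by (rule runs_instr) simp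
  then show "runs P xs (cost W (Num c)) q st (q + length (compile (Num c) q rs (length st)))
      (st @ [eval xs (Num c) (map ((!) st) rs)])"
    by simp
qed

lemma compiles_Var: "compiles P xs W (Var i)"
proof (rule compilesI)
  fix q and rs st :: "nat list"
  assume code: "code_at P q (compile (Var i) q rs (length st))" and rs: "\<forall>r\<in>set rs. r < length st"
  have "runs P xs 1 q st (Suc q) (st @ [eval xs (Var i) (map ((!) st) rs)])"
    by (rule runs_instr[OF code[unfolded compile.simps]]) (use rs in \<open>auto simp: stack_nth\<close>)
  then show "runs P xs (cost W (Var i)) q st (q + length (compile (Var i) q rs (length st)))
      (st @ [eval xs (Var i) (map ((!) st) rs)])"
    by simp
qed

lemma compiles_unary:
  assumes a: "compiles P xs W a"
    and code: "\<And>q rs t. compile e q rs t = compile a q rs t @ [instr_at t]"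
    and bounded: "\<And>env. loops_bounded W xs e env \<Longrightarrow> loops_bounded W xs a env"
    and cost: "cost W e = cost W a + 1"
    and exec: "\<And>q R t. exec xs (instr_at t) (q, R) = (Suc q, R(t := f (R t)))"
    and eval: "\<And>env. eval xs e env = f (eval xs a env)"
  shows "compiles P xs W e"
proof (rule compilesI)
  fix q and rs st :: "nat list"
  assume e: "code_at P q (compile e q rs (length st))"
    "\<forall>r\<in>set rs. r < length st" "loops_bounded W xs e (map ((!) st) rs)"
  let ?env = "map ((!) st) rs" and ?q = "q + length (compile a q rs (length st))"
  have "runs P xs (cost W a) q st ?q (st @ [eval xs a ?env])"
    by (rule compilesD[OF a]) (use e bounded code in simp_all)
  also have "runs P xs 1 ?q (st @ [eval xs a ?env]) (Suc ?q) (st @ [eval xs e ?env])"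
    by (rule runs_instr[of _ _ "instr_at (length st)"]) (use e code in \<open>simp_all add: exec eval\<close>)
  finally show "runs P xs (cost W e) q st (q + length (compile e q rs (length st)))
      (st @ [eval xs e ?env])"
    by (simp add: cost code)
qed

lemma compiles_binary:
  assumes a: "compiles P xs W a" and b: "compiles P xs W b"
    and code: "\<And>q rs t. compile e q rs t =
      (let ca = compile a q rs t; cb = compile b (q + length ca) rs (t + 1)
       in ca @ cb @ [instr_at t])"
    and bounded: "\<And>env. loops_bounded W xs e env \<Longrightarrow>
      loops_bounded W xs a env \<and> loops_bounded W xs b env"
    and cost: "cost W e = cost W a + cost W b + 1"
    and exec: "\<And>q R t. exec xs (instr_at t) (q, R) = (Suc q, R(t := f (R t) (R (t + 1))))"
    and eval: "\<And>env. eval xs e env = f (eval xs a env) (eval xs b env)"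
  shows "compiles P xs W e"
proof (rule compilesI)
  fix q and rs st :: "nat list"
  assume e: "code_at P q (compile e q rs (length st))"
    "\<forall>r\<in>set rs. r < length st" "loops_bounded W xs e (map ((!) st) rs)"
  let ?env = "map ((!) st) rs" and ?qa = "q + length (compile a q rs (length st))"
  let ?st = "st @ [eval xs a ?env]"
  let ?qb = "?qa + length (compile b ?qa rs (length st + 1))"
  have "runs P xs (cost W a) q st ?qa ?st"
    by (rule compilesD[OF a]) (use e bounded code in \<open>simp_all add: Let_def\<close>)
  also have "runs P xs (cost W b) ?qa ?st ?qb (?st @ [eval xs b ?env])"
    by (rule compilesD[OF b])
      (use e bounded code map_nth_append[OF e(2)] in \<open>auto simp: Let_def\<close>)
  also have "runs P xs 1 ?qb (?st @ [eval xs b ?env]) (Suc ?qb) (st @ [eval xs e ?env])"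
    by (rule runs_instr[of _ _ "instr_at (length st)"])
      (use e code in \<open>simp_all add: exec eval Let_def All_less_Suc2\<close>)
  finally show "runs P xs (cost W e) q st (q + length (compile e q rs (length st)))
      (st @ [eval xs e ?env])"
    by (simp add: cost code Let_def add.assoc)
qed

lemma compiles_Cond:
  assumes a: "compiles P xs W a" and b: "compiles P xs W b" and c: "compiles P xs W c"
  shows "compiles P xs W (Cond a b c)"
proof (rule compilesI)
  fix q and rs st :: "nat list"
  let ?t = "length st" and ?env = "map ((!) st) rs"
  let ?qa = "q + length (compile a q rs ?t)"
  let ?qb = "?qa + 1 + length (compile b (?qa + 1) rs ?t)"
  let ?qc = "?qb + 1 + length (compile c (?qb + 1) rs ?t)"
  assume "code_at P q (compile (Cond a b c) q rs ?t)" and rs: "\<forall>r\<in>set rs. r < ?t"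
    and bounded: "loops_bounded W xs (Cond a b c) ?env"
  then have code: "code_at P q (compile a q rs ?t)" "code_at P ?qa [Jzero ?t (?qb + 1)]"
    "code_at P (?qa + 1) (compile b (?qa + 1) rs ?t)" "code_at P ?qb [Jump ?qc]"
    "code_at P (?qb + 1) (compile c (?qb + 1) rs ?t)"
    by (simp_all add: Let_def)
  let ?v = "eval xs a ?env"
  have test: "runs P xs (cost W a) q st ?qa (st @ [?v])"
    by (rule compilesD[OF a]) (use code rs bounded in simp_all)
  have "runs P xs (cost W (Cond a b c)) q st ?qc (st @ [eval xs (Cond a b c) ?env])"
  proof (cases "?v = 0")
    case True
    note test
    also have "runs P xs 1 ?qa (st @ [?v]) (?qb + 1) st"
      by (rule runs_instr[OF code(2)]) (simp add: True)
    also have "runs P xs (cost W c) (?qb + 1) st ?qc (st @ [eval xs c ?env])"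
      by (rule compilesD[OF c]) (use code rs bounded True in simp_all)
    finally have "runs P xs (cost W (Cond a b c)) q st ?qc (st @ [eval xs c ?env])"
      by (rule runs_mono) simp
    then show ?thesis by (simp add: True)
  next
    case False
    note test
    also have "runs P xs 1 ?qa (st @ [?v]) (?qa + 1) st"
      by (rule runs_instr[OF code(2)]) (simp add: False)
    also have "runs P xs (cost W b) (?qa + 1) st ?qb (st @ [eval xs b ?env])"
      by (rule compilesD[OF b]) (use code rs bounded False in simp_all)
    also have "runs P xs 1 ?qb (st @ [eval xs b ?env]) ?qc (st @ [eval xs b ?env])"
      by (rule runs_instr[OF code(4)]) simp
    finally have "runs P xs (cost W (Cond a b c)) q st ?qc (st @ [eval xs b ?env])"
      by (rule runs_mono) simp
    then show ?thesis by (simp add: False)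
  qed
  then show "runs P xs (cost W (Cond a b c)) q st
      (q + length (compile (Cond a b c) q rs ?t)) (st @ [eval xs (Cond a b c) ?env])"
    by (simp add: Let_def add.assoc)
qed

lemma compiles_Bind:
  assumes a: "compiles P xs W a" and b: "compiles P xs W b"
  shows "compiles P xs W (Bind a b)"
proof (rule compilesI)
  fix q and rs st :: "nat list"
  let ?t = "length st" and ?env = "map ((!) st) rs"
  let ?v = "eval xs a ?env"
  let ?qa = "q + length (compile a q rs ?t)"
  let ?qb = "?qa + length (compile b ?qa (rs @ [?t]) (?t + 1))"
  assume code: "code_at P q (compile (Bind a b) q rs ?t)" and rs: "\<forall>r\<in>set rs. r < ?t"
    and bounded: "loops_bounded W xs (Bind a b) ?env"
  have "runs P xs (cost W a) q st ?qa (st @ [?v])"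
    by (rule compilesD[OF a]) (use code rs bounded in \<open>simp_all add: Let_def\<close>)
  also have "runs P xs (cost W b) ?qa (st @ [?v]) ?qb ((st @ [?v]) @ [eval xs b (?env @ [?v])])"
    by (rule compilesD[OF b])
      (use code rs bounded map_nth_append[OF rs] in \<open>auto simp: Let_def\<close>)
  also have "runs P xs 1 ?qb ((st @ [?v]) @ [eval xs b (?env @ [?v])]) (Suc ?qb)
      (st @ [eval xs b (?env @ [?v])])"
    by (rule runs_instr[of _ _ "Copy ?t (?t + 1)"])
      (use code in \<open>simp_all add: Let_def All_less_Suc2\<close>)
  finally show "runs P xs (cost W (Bind a b)) q st (q + length (compile (Bind a b) q rs ?t))
      (st @ [eval xs (Bind a b) ?env])"
    by (simp add: Let_def add.assoc)
qed

lemma compiles_Last: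
  assumes "compiles P xs W a"
  shows "compiles P xs W (Last k a)"
proof (rule compilesI)
  fix q and rs st :: "nat list"
  assume "code_at P q (compile (Last k a) q rs (length st))" "\<forall>r\<in>set rs. r < length st"
    "loops_bounded W xs (Last k a) (map ((!) st) rs)"
  then show "runs P xs (cost W (Last k a)) q st (q + length (compile (Last k a) q rs (length st)))
      (st @ [eval xs (Last k a) (map ((!) st) rs)])"
    using compilesD[OF assms, of "length st" st q "drop (length rs - k) rs"]
    by (simp add: drop_map) (meson in_set_dropD)
qed

lemma compiles_Init:
  assumes "compiles P xs W a"
  shows "compiles P xs W (Init a)"
proof (rule compilesI)
  fix q and rs st :: "nat list"
  assume "code_at P q (compile (Init a) q rs (length st))" "\<forall>r\<in>set rs. r < length st"
    "loops_bounded W xs (Init a) (map ((!) st) rs)"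
  then show "runs P xs (cost W (Init a)) q st (q + length (compile (Init a) q rs (length st)))
      (st @ [eval xs (Init a) (map ((!) st) rs)])"
    using compilesD[OF assms, of "length st" st q "butlast rs"]
    by (simp add: map_butlast[symmetric]) (meson in_set_butlastD)
qed

lemma runs_loop_iteration:
  fixes st :: "nat list"
  defines "t \<equiv> length st"
  assumes c: "compiles P xs W c"
    and test: "code_at P start [Sub (t + 3) t (t + 2), Jzero (t + 3) exit]"
    and body: "code_at P (start + 2) (compile c (start + 2) (rs @ [t + 2, t + 1]) (t + 3))"
    and "end": "code_at P (start + 2 + length (compile c (start + 2) (rs @ [t + 2, t + 1]) (t + 3)))
      [Copy (t + 1) (t + 3), Const (t + 3) 1, Add (t + 2) (t + 2) (t + 3), Jump start]"
    and rs: "\<forall>r\<in>set rs. r < t" and i: "i < n"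
    and bounded: "loops_bounded W xs c (map ((!) st) rs @ [i, r])"
  shows "runs P xs (cost W c + 6) start (st @ [n, r, i]) start
    (st @ [n, eval xs c (map ((!) st) rs @ [i, r]), i + 1])"
proof -
  let ?q = "start + 2 + length (compile c (start + 2) (rs @ [t + 2, t + 1]) (t + 3))"
  let ?v = "eval xs c (map ((!) st) rs @ [i, r])"
  have "runs P xs 1 start (st @ [n, r, i]) (start + 1) (st @ [n, r, i, n - i])"
    by (rule runs_instr[of _ _ "Sub (t + 3) t (t + 2)"])
      (use test in \<open>simp_all add: t_def All_less_Suc2 eval_nat_numeral\<close>)
  also have "runs P xs 1 (start + 1) (st @ [n, r, i, n - i]) (start + 2) (st @ [n, r, i])"
    by (rule runs_instr[of _ _ "Jzero (t + 3) exit"])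
      (use test i in \<open>simp_all add: t_def All_less_Suc2 eval_nat_numeral\<close>)
  also have "runs P xs (cost W c) (start + 2) (st @ [n, r, i]) ?q ((st @ [n, r, i]) @ [?v])"
    by (rule compilesD[OF c])
      (use body rs bounded map_nth_append[of rs st] in \<open>auto simp: t_def nth_append\<close>)
  also have "runs P xs 1 ?q ((st @ [n, r, i]) @ [?v]) (?q + 1) (st @ [n, ?v, i])"
    by (rule runs_instr[of _ _ "Copy (t + 1) (t + 3)"])
      (use "end" in \<open>simp_all add: t_def All_less_Suc2 eval_nat_numeral\<close>)
  also have "runs P xs 1 (?q + 1) (st @ [n, ?v, i]) (?q + 2) (st @ [n, ?v, i, 1])"
    by (rule runs_instr[of _ _ "Const (t + 3) 1"])
      (use "end" in \<open>simp_all add: t_def All_less_Suc2 eval_nat_numeral\<close>)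
  also have "runs P xs 1 (?q + 2) (st @ [n, ?v, i, 1]) (?q + 3) (st @ [n, ?v, i + 1])"
    by (rule runs_instr[of _ _ "Add (t + 2) (t + 2) (t + 3)"])
      (use "end" in \<open>simp_all add: t_def All_less_Suc2 eval_nat_numeral\<close>)
  also have "runs P xs 1 (?q + 3) (st @ [n, ?v, i + 1]) start (st @ [n, ?v, i + 1])"
    by (rule runs_instr[of _ _ "Jump start"])
      (use "end" in \<open>simp_all add: t_def All_less_Suc2 eval_nat_numeral\<close>)
  finally show ?thesis by (rule runs_mono) simp
qed

lemma runs_loop_exit:
  fixes st :: "nat list"
  defines "t \<equiv> length st"
  assumes test: "code_at P start [Sub (t + 3) t (t + 2), Jzero (t + 3) exit]"
    and result: "code_at P exit [Copy t (t + 1)]"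
  shows "runs P xs 3 start (st @ [n, r, n]) (exit + 1) (st @ [r])"
proof -
  have "runs P xs 1 start (st @ [n, r, n]) (start + 1) (st @ [n, r, n, 0])"
    by (rule runs_instr[of _ _ "Sub (t + 3) t (t + 2)"])
      (use test in \<open>simp_all add: t_def All_less_Suc2 eval_nat_numeral\<close>)
  also have "runs P xs 1 (start + 1) (st @ [n, r, n, 0]) exit (st @ [n, r])"
    by (rule runs_instr[of _ _ "Jzero (t + 3) exit"])
      (use test in \<open>simp_all add: t_def All_less_Suc2 eval_nat_numeral\<close>)
  also have "runs P xs 1 exit (st @ [n, r]) (exit + 1) (st @ [r])"
    by (rule runs_instr[OF result]) (simp add: t_def All_less_Suc2)
  finally show ?thesis by (simp add: eval_nat_numeral)
qed

lemma compiles_Loop: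
  assumes a: "compiles P xs W a" and b: "compiles P xs W b" and c: "compiles P xs W c"
  shows "compiles P xs W (Loop a b c)"
proof (rule compilesI)
  fix q and rs st :: "nat list"
  let ?t = "length st" and ?env = "map ((!) st) rs"
  let ?qa = "q + length (compile a q rs ?t)"
  let ?qb = "?qa + length (compile b ?qa rs (?t + 1))"
  let ?start = "?qb + 1"
  let ?qc = "?start + 2 + length (compile c (?start + 2) (rs @ [?t + 2, ?t + 1]) (?t + 3))"
  let ?exit = "?qc + 4"
  assume "code_at P q (compile (Loop a b c) q rs ?t)" and rs: "\<forall>r\<in>set rs. r < ?t"
    and bounded: "loops_bounded W xs (Loop a b c) ?env"
  then have code: "code_at P q (compile a q rs ?t)" "code_at P ?qa (compile b ?qa rs (?t + 1))"
    "code_at P ?qb [Const (?t + 2) 0]"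
    "code_at P ?start [Sub (?t + 3) ?t (?t + 2), Jzero (?t + 3) ?exit]"
    "code_at P (?start + 2) (compile c (?start + 2) (rs @ [?t + 2, ?t + 1]) (?t + 3))"
    "code_at P ?qc
      [Copy (?t + 1) (?t + 3), Const (?t + 3) 1, Add (?t + 2) (?t + 2) (?t + 3), Jump ?start]"
    "code_at P ?exit [Copy ?t (?t + 1)]"
    by (simp_all add: Let_def eval_nat_numeral)
  define n where "n = eval xs a ?env"
  define r where "r i = fold (\<lambda>i r. eval xs c (?env @ [i, r])) [0..<i] (eval xs b ?env)" for i
  have iteration: "runs P xs (cost W c + 6) ?start (st @ [n, r i, i]) ?start
      (st @ [n, r (Suc i), Suc i])" if "i < n" for i
    using runs_loop_iteration[OF c code(4-6) rs that, of "r i"] bounded that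
    by (simp add: r_def n_def)
  have "runs P xs (cost W a) q st ?qa (st @ [n])"
    unfolding n_def by (rule compilesD[OF a]) (use code rs bounded in simp_all)
  also have "runs P xs (cost W b) ?qa (st @ [n]) ?qb ((st @ [n]) @ [r 0])"
    unfolding r_def by (simp, rule compilesD[OF b, where st = "st @ [n]" and rs = rs, simplified])
      (use code rs bounded map_nth_append[OF rs] in auto)
  also have "runs P xs 1 ?qb ((st @ [n]) @ [r 0]) ?start (st @ [n, r 0, 0])"
    by (rule runs_instr[OF code(3)]) (simp add: All_less_Suc2 eval_nat_numeral)
  also have "runs P xs (n * (cost W c + 6)) ?start (st @ [n, r 0, 0]) ?start (st @ [n, r n, n])"
    using iteration by (rule runs_iterate)
  also have "runs P xs 3 ?start (st @ [n, r n, n]) (?exit + 1) (st @ [r n])"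
    using code(4,7) by (rule runs_loop_exit)
  finally have "runs P xs (cost W (Loop a b c)) q st (?exit + 1) (st @ [r n])"
    by (rule runs_mono) (use bounded in \<open>simp add: n_def\<close>)
  then show "runs P xs (cost W (Loop a b c)) q st (q + length (compile (Loop a b c) q rs ?t))
      (st @ [eval xs (Loop a b c) ?env])"
    by (simp add: Let_def r_def n_def eval_nat_numeral add.assoc)
qed

theorem compile_correct: "compiles P xs W e"
proof (induction e)
  case (Inp a)
  then show ?case by (rule compiles_unary[where instr_at = "\<lambda>t. Read t t"]) auto
next
  case (Hlf a)
  then show ?case by (rule compiles_unary[where instr_at = "\<lambda>t. Half t t"]) auto
next
  case (Plus a b)
  then show ?case by (rule compiles_binary[where instr_at = "\<lambda>t. Add t t (t + 1)"]) auto
next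
  case (Minus a b)
  then show ?case by (rule compiles_binary[where instr_at = "\<lambda>t. Sub t t (t + 1)"]) auto
qed (rule compiles_Num compiles_Var compiles_Cond compiles_Bind compiles_Last compiles_Init
    compiles_Loop; assumption)+

corollary outputs_within_compile:
  assumes "loops_bounded W xs e []"
  shows "outputs_within (compile e 0 [] 0) xs (cost W e) (eval xs e [])"
proof -
  let ?P = "compile e 0 [] 0"
  have "runs ?P xs (cost W e) 0 [] (length ?P) [eval xs e []]"
    using compilesD[OF compile_correct, of 0 "[]" ?P 0 e "[]" W xs "[]"] code_at_suffix[of "[]" ?P]
      assms by simp
  then obtain t R where "t \<le> cost W e" "(step ?P xs ^^ t) (0, \<lambda>_. 0) = (length ?P, R)"
    "stack [eval xs e []] R"
    unfolding runs_def by (metis stack_Nil)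
  then show ?thesis unfolding outputs_within_def run_def halted_def stack_def by force
qed

lemma eventually_loops_bounded: "\<forall>\<^sub>F W in at_top. loops_bounded W xs e env"
proof (induction e arbitrary: env)
  case (Loop a b c)
  have "\<forall>\<^sub>F W in at_top. \<forall>i\<in>{..<eval xs a env}. loops_bounded W xs c
      (env @ [i, fold (\<lambda>i r. eval xs c (env @ [i, r])) [0..<i] (eval xs b env)])"
    using Loop.IH(3) by (intro eventually_ball_finite) auto
  then show ?case
    using Loop.IH(1,2)[of env] by (simp add: eventually_conj_iff Ball_def)
qed (simp_all add: eventually_conj_iff)

corollary computable_eval: "computable (\<lambda>k. eval [k] e [])"
  unfolding computable_def
proof (intro exI allI)
  fix k
  have "\<exists>W. loops_bounded W [k] e []"
    using eventually_happens[OF eventually_loops_bounded] by simp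
  then show "outputs_within (compile e 0 [] 0) [k] (cost (SOME W. loops_bounded W [k] e []) e)
      (eval [k] e [])"
    by (intro outputs_within_compile) (rule someI_ex)
qed

subsection \<open>Polynomial running time\<close>

definition poly_bounded :: "(nat \<Rightarrow> nat) \<Rightarrow> bool" where
  "poly_bounded f \<longleftrightarrow> (\<exists>K D. \<forall>x\<ge>1. f x \<le> K * x ^ D)"

lemma poly_bounded_const: "poly_bounded (\<lambda>_. c)"
  unfolding poly_bounded_def by (rule exI[of _ c], rule exI[of _ 0]) simp

lemma poly_bounded_ident: "poly_bounded (\<lambda>x. x)"
  unfolding poly_bounded_def by (rule exI[of _ 1], rule exI[of _ 1]) simp

lemma poly_bounded_add:
  assumes "poly_bounded f" "poly_bounded g"
  shows "poly_bounded (\<lambda>x. f x + g x)"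
proof -
  obtain K D where f: "\<And>x. x \<ge> 1 \<Longrightarrow> f x \<le> K * x ^ D"
    using assms(1) unfolding poly_bounded_def by blast
  obtain K' D' where g: "\<And>x. x \<ge> 1 \<Longrightarrow> g x \<le> K' * x ^ D'"
    using assms(2) unfolding poly_bounded_def by blast
  have "f x + g x \<le> (K + K') * x ^ (D + D')" if "x \<ge> 1" for x
  proof -
    have "K * x ^ D \<le> K * x ^ (D + D')" "K' * x ^ D' \<le> K' * x ^ (D + D')"
      using that by (simp_all add: power_increasing)
    with f[OF that] g[OF that] show ?thesis unfolding distrib_right by linarith
  qed
  then show ?thesis unfolding poly_bounded_def by blast
qed

lemma poly_bounded_mult:
  assumes "poly_bounded f" "poly_bounded g"
  shows "poly_bounded (\<lambda>x. f x * g x)"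
proof -
  obtain K D where f: "\<And>x. x \<ge> 1 \<Longrightarrow> f x \<le> K * x ^ D"
    using assms(1) unfolding poly_bounded_def by blast
  obtain K' D' where g: "\<And>x. x \<ge> 1 \<Longrightarrow> g x \<le> K' * x ^ D'"
    using assms(2) unfolding poly_bounded_def by blast
  have "f x * g x \<le> (K * K') * x ^ (D + D')" if "x \<ge> 1" for x
    using mult_le_mono[OF f[OF that] g[OF that]] by (simp add: power_add mult_ac)
  then show ?thesis unfolding poly_bounded_def by blast
qed

lemma poly_bounded_cost: "poly_bounded (\<lambda>W. cost W e)"
  by (induction e)
    (simp_all only: cost.simps poly_bounded_add poly_bounded_mult poly_bounded_const
      poly_bounded_ident)

section \<open>Representations by boxes\<close>

definition boxes_meet ::
    "nat \<Rightarrow> ('a \<Rightarrow> nat \<Rightarrow> 'b::linorder) \<Rightarrow> ('a \<Rightarrow> nat \<Rightarrow> 'b) \<Rightarrow> 'a \<Rightarrow> 'a \<Rightarrow> bool" where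
  "boxes_meet d l r u v \<longleftrightarrow> (\<forall>i<d. l u i \<le> r v i \<and> l v i \<le> r u i)"

text \<open>\<open>E\<close> is meant to be reflexive: the instances \<open>u = v\<close> then state that the intervals are
  nonempty.\<close>

definition box_representable :: "'a set \<Rightarrow> ('a \<Rightarrow> 'a \<Rightarrow> bool) \<Rightarrow> nat \<Rightarrow> bool" where
  "box_representable A E d \<longleftrightarrow>
     (\<exists>l r :: 'a \<Rightarrow> nat \<Rightarrow> real. \<forall>u\<in>A. \<forall>v\<in>A. E u v \<longleftrightarrow> boxes_meet d l r u v)"

lemma boxes_meet_commute: "boxes_meet d l r u v \<longleftrightarrow> boxes_meet d l r v u"
  unfolding boxes_meet_def by blast

lemma box_representableI:
  fixes l r :: "'a \<Rightarrow> nat \<Rightarrow> real"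
  assumes "\<And>u v. u \<in> A \<Longrightarrow> v \<in> A \<Longrightarrow> E u v \<longleftrightarrow> boxes_meet d l r u v"
  shows "box_representable A E d"
  unfolding box_representable_def by (intro exI[of _ l] exI[of _ r] ballI assms)

lemma box_representable_vimage:
  fixes t :: "'a \<Rightarrow> 'b"
  assumes "box_representable B F d" "t ` A \<subseteq> B"
    and "\<And>u v. u \<in> A \<Longrightarrow> v \<in> A \<Longrightarrow> E u v \<longleftrightarrow> F (t u) (t v)"
  shows "box_representable A E d"
proof -
  obtain l r :: "'b \<Rightarrow> nat \<Rightarrow> real" where "\<forall>u\<in>B. \<forall>v\<in>B. F u v \<longleftrightarrow> boxes_meet d l r u v"
    using assms(1) unfolding box_representable_def by blast
  then have "E u v \<longleftrightarrow> boxes_meet d (l \<circ> t) (r \<circ> t) u v" if "u \<in> A" "v \<in> A" for u v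
    using assms(2,3) that by (auto simp: boxes_meet_def)
  then show ?thesis by (rule box_representableI)
qed

lemma box_representable_subset:
  "box_representable B E d \<Longrightarrow> A \<subseteq> B \<Longrightarrow> box_representable A E d"
  using box_representable_vimage[of B E d "\<lambda>v. v"] by simp

lemma box_representable_conj:
  fixes A :: "'a set"
  assumes "box_representable A E d" "box_representable A F d'"
  shows "box_representable A (\<lambda>u v. E u v \<and> F u v) (d + d')"
proof -
  obtain l r :: "'a \<Rightarrow> nat \<Rightarrow> real"
    where E: "\<forall>u\<in>A. \<forall>v\<in>A. E u v \<longleftrightarrow> boxes_meet d l r u v"
    using assms(1) unfolding box_representable_def by blast
  obtain l' r' :: "'a \<Rightarrow> nat \<Rightarrow> real"
    where F: "\<forall>u\<in>A. \<forall>v\<in>A. F u v \<longleftrightarrow> boxes_meet d' l' r' u v"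
    using assms(2) unfolding box_representable_def by blast
  let ?l = "\<lambda>u i. if i < d then l u i else l' u (i - d)"
  let ?r = "\<lambda>u i. if i < d then r u i else r' u (i - d)"
  have "boxes_meet (d + d') ?l ?r u v \<longleftrightarrow> boxes_meet d l r u v \<and> boxes_meet d' l' r' u v" for u v
    by (simp add: boxes_meet_def all_less_add_iff)
  with E F show ?thesis by (intro box_representableI[of _ _ _ ?l ?r]) simp
qed

lemma box_representable_True: "box_representable A (\<lambda>_ _. True) d"
  by (rule box_representableI[of _ _ _ "\<lambda>_ _. 0" "\<lambda>_ _. 0"]) (simp add: boxes_meet_def)

lemma box_representable_mono:
  assumes "box_representable A E d" "d \<le> d'"
  shows "box_representable A E d'"
  using box_representable_conj[OF assms(1) box_representable_True, of "d' - d"] assms(2) by simp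

lemma box_representable_Ball:
  assumes "finite I" "\<And>i. i \<in> I \<Longrightarrow> box_representable A (E i) d"
  shows "box_representable A (\<lambda>u v. \<forall>i\<in>I. E i u v) (card I * d)"
  using assms
proof (induction I rule: finite_induct)
  case empty
  then show ?case by (simp add: box_representable_True)
next
  case (insert i I)
  from box_representable_conj[OF insert.prems[of i] insert.IH] insert show ?case by simp
qed

lemma box_representable_intervals:
  fixes l r :: "'a \<Rightarrow> real"
  assumes "\<And>u v. u \<in> A \<Longrightarrow> v \<in> A \<Longrightarrow> E u v \<longleftrightarrow> l u \<le> r v \<and> l v \<le> r u"
  shows "box_representable A E 1"
  by (rule box_representableI[of _ _ _ "\<lambda>u _. l u" "\<lambda>u _. r u"])
    (use assms in \<open>simp add: boxes_meet_def\<close>)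

subsection \<open>Integer endpoints\<close>

definition rank_in :: "'a::linorder set \<Rightarrow> 'a \<Rightarrow> nat" where
  "rank_in Y x = card {y \<in> Y. y < x}"

lemma rank_in_less_card: "finite Y \<Longrightarrow> x \<in> Y \<Longrightarrow> rank_in Y x < card Y"
  unfolding rank_in_def by (rule psubset_card_mono) auto

lemma rank_in_le_iff:
  assumes "finite Y" "x \<in> Y" "y \<in> Y"
  shows "rank_in Y x \<le> rank_in Y y \<longleftrightarrow> x \<le> y"
proof -
  have "rank_in Y a < rank_in Y b" if "a \<in> Y" "a < b" for a b
    unfolding rank_in_def by (rule psubset_card_mono) (use assms(1) that in auto)
  then show ?thesis using assms(2,3) by (metis linorder_not_less order.order_iff_strict)
qed

lemma bij_betw_rank_in:
  assumes "finite Y"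
  shows "bij_betw (rank_in Y) Y {..<card Y}"
proof -
  have "inj_on (rank_in Y) Y"
    by (rule inj_onI) (metis assms order.antisym order.refl rank_in_le_iff)
  moreover have "rank_in Y ` Y \<subseteq> {..<card Y}" using rank_in_less_card[OF assms] by auto
  ultimately show ?thesis
    unfolding bij_betw_def by (metis card_image card_lessThan card_subset_eq finite_lessThan)
qed

lemma box_representable_nat_endpoints:
  fixes A :: "'a set"
  assumes fin: "finite A" and "box_representable A E d"
  obtains l r :: "'a \<Rightarrow> nat \<Rightarrow> nat"
  where "\<And>u i. u \<in> A \<Longrightarrow> l u i < 2 * card A" "\<And>u i. u \<in> A \<Longrightarrow> r u i < 2 * card A"
    and "\<And>u v. u \<in> A \<Longrightarrow> v \<in> A \<Longrightarrow> E u v \<longleftrightarrow> boxes_meet d l r u v"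
proof -
  obtain l r :: "'a \<Rightarrow> nat \<Rightarrow> real"
    where E: "\<forall>u\<in>A. \<forall>v\<in>A. E u v \<longleftrightarrow> boxes_meet d l r u v"
    using assms(2) unfolding box_representable_def by blast
  define Y where "Y i = (\<lambda>u. l u i) ` A \<union> (\<lambda>u. r u i) ` A" for i
  have fin_Y: "finite (Y i)" for i using fin by (simp add: Y_def)
  have "card (Y i) \<le> 2 * card A" for i
    unfolding Y_def using card_Un_le[of "(\<lambda>u. l u i) ` A" "(\<lambda>u. r u i) ` A"]
      card_image_le[OF fin, of "\<lambda>u. l u i"] card_image_le[OF fin, of "\<lambda>u. r u i"] by linarith
  then have less: "rank_in (Y i) y < 2 * card A" if "y \<in> Y i" for i y
    using rank_in_less_card[OF fin_Y that] by (rule less_le_trans[rotated])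
  have "l u i \<in> Y i" "r u i \<in> Y i" if "u \<in> A" for u i using that by (auto simp: Y_def)
  with E less rank_in_le_iff[OF fin_Y] show thesis
    by (intro that[of "\<lambda>u i. rank_in (Y i) (l u i)" "\<lambda>u i. rank_in (Y i) (r u i)"])
      (simp_all add: boxes_meet_def)
qed

subsection \<open>Shrinking an interval within a cell\<close>

definition same_cell :: "'a::linorder set \<Rightarrow> 'a \<Rightarrow> 'a \<Rightarrow> bool" where
  "same_cell Y p q \<longleftrightarrow> (\<forall>y\<in>Y. (y \<le> p \<longleftrightarrow> y \<le> q) \<and> (p \<le> y \<longleftrightarrow> q \<le> y))"

text \<open>The interval \<open>[a, b]\<close> contains \<open>p\<close>, and \<open>z\<close> lies in the same cell as \<open>p\<close>.\<close>

definition shrink_left :: "'a::linorder set \<Rightarrow> 'a \<Rightarrow> 'a \<Rightarrow> 'a \<Rightarrow> 'a" where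
  "shrink_left Y p z a = (if Y \<inter> {a..p} = {} then z else a)"

definition shrink_right :: "'a::linorder set \<Rightarrow> 'a \<Rightarrow> 'a \<Rightarrow> 'a \<Rightarrow> 'a" where
  "shrink_right Y p z b = (if Y \<inter> {p..b} = {} then z else b)"

lemma same_cell_refl: "same_cell Y p p"
  by (simp add: same_cell_def)

text \<open>The point \<open>p\<close> lies in the interval \<open>[a, b]\<close>, and \<open>p'\<close> in \<open>[a', b']\<close>.\<close>

definition same_position :: "'a::linorder set \<Rightarrow> 'a \<Rightarrow> 'a \<Rightarrow> 'a \<Rightarrow> 'a \<Rightarrow> 'a \<Rightarrow> 'a \<Rightarrow> bool" where
  "same_position Y a p b a' p' b' \<longleftrightarrow> same_cell Y p p' \<and>
     (Y \<inter> {a..p} = {} \<longleftrightarrow> Y \<inter> {a'..p'} = {}) \<and> (Y \<inter> {p..b} = {} \<longleftrightarrow> Y \<inter> {p'..b'} = {})"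

lemma same_cell_sym: "same_cell Y p q \<Longrightarrow> same_cell Y q p"
  by (auto simp: same_cell_def)

lemma same_cell_between:
  assumes "same_cell Y p q" "p \<le> z \<and> z \<le> q \<or> q \<le> z \<and> z \<le> p"
  shows "same_cell Y p z"
  using assms unfolding same_cell_def by (meson order_trans)

lemma same_cell_gap:
  assumes "same_cell Y p q" "p \<le> b" "b < a" "a \<le> q"
  shows "Y \<inter> {p..b} = {}" "Y \<inter> {a..q} = {}"
  using assms unfolding same_cell_def by fastforce+

lemma shrink_left_le_iff:
  assumes "same_cell Y p z" "a \<le> p" "y \<in> Y"
  shows "shrink_left Y p z a \<le> y \<longleftrightarrow> a \<le> y"
  using assms unfolding shrink_left_def same_cell_def by (auto; meson linear order_trans)

lemma le_shrink_right_iff: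
  assumes "same_cell Y p z" "p \<le> b" "y \<in> Y"
  shows "y \<le> shrink_right Y p z b \<longleftrightarrow> y \<le> b"
  using assms unfolding shrink_right_def same_cell_def by (auto; meson linear order_trans)

lemma shrink_left_le: "same_cell Y p z \<Longrightarrow> shrink_left Y p z a \<le> z"
  unfolding shrink_left_def same_cell_def by (auto intro: order_trans)

lemma le_shrink_right: "same_cell Y p z \<Longrightarrow> z \<le> shrink_right Y p z b"
  unfolding shrink_right_def same_cell_def by (auto intro: order_trans)

lemma less_shrink_left: "x < a \<Longrightarrow> a \<le> p \<Longrightarrow> (x < p \<Longrightarrow> x < z) \<Longrightarrow> x < shrink_left Y p z a"
  unfolding shrink_left_def by auto

lemma shrink_right_less: "b < x \<Longrightarrow> p \<le> b \<Longrightarrow> (p < x \<Longrightarrow> z < x) \<Longrightarrow> shrink_right Y p z b < x"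
  unfolding shrink_right_def by auto

lemma exists_near_towards:
  fixes p p' :: real
  assumes "finite Y"
  shows "\<exists>z. (p = p' \<longrightarrow> z = p) \<and> (p < p' \<longrightarrow> p < z \<and> z < p') \<and> (p' < p \<longrightarrow> p' < z \<and> z < p) \<and>
    (\<forall>y\<in>Y. (y < p \<longrightarrow> y < z) \<and> (p < y \<longrightarrow> z < y))"
proof -
  let ?z = "\<lambda>t. p + t * (p' - p)"
  have lim: "(?z \<longlongrightarrow> p) (at_right 0)" by (auto intro!: tendsto_eq_intros)
  have "\<forall>\<^sub>F t in at_right 0. (y < p \<longrightarrow> y < ?z t) \<and> (p < y \<longrightarrow> ?z t < y)" for y
    using order_tendstoD[OF lim, of y] by (cases y p rule: linorder_cases) auto
  then have "\<forall>\<^sub>F t in at_right 0. \<forall>y\<in>Y. (y < p \<longrightarrow> y < ?z t) \<and> (p < y \<longrightarrow> ?z t < y)"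
    using assms by (intro eventually_ball_finite) auto
  moreover have "\<forall>\<^sub>F t :: real in at_right 0. t \<in> {0<..<1}" by (rule eventually_at_right_real) simp
  ultimately have "\<forall>\<^sub>F t in at_right 0. t \<in> {0<..<1} \<and>
      (\<forall>y\<in>Y. (y < p \<longrightarrow> y < ?z t) \<and> (p < y \<longrightarrow> ?z t < y))"
    by eventually_elim simp
  then obtain t where t: "0 < t" "t < 1" "\<forall>y\<in>Y. (y < p \<longrightarrow> y < ?z t) \<and> (p < y \<longrightarrow> ?z t < y)"
    using eventually_happens by fastforce
  have "p < ?z t \<and> ?z t < p'" if "p < p'"
  proof -
    have "0 < t * (p' - p)" "t * (p' - p) < 1 * (p' - p)"
      using that t(1,2) by (intro mult_pos_pos mult_strict_right_mono; simp)+
    then show ?thesis by auto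
  qed
  moreover have "p' < ?z t \<and> ?z t < p" if "p' < p"
  proof -
    have "t * (p' - p) < 0" "1 * (p' - p) < t * (p' - p)"
      using that t(1,2) by (intro mult_pos_neg mult_strict_right_mono_neg; simp)+
    then show ?thesis by auto
  qed
  ultimately show ?thesis using t(3) by (intro exI[of _ "?z t"]) auto
qed

section \<open>Adding a copy of a cluster\<close>

definition endpoints :: "('a \<Rightarrow> nat \<Rightarrow> 'b) \<Rightarrow> ('a \<Rightarrow> nat \<Rightarrow> 'b) \<Rightarrow> 'a set \<Rightarrow> nat \<Rightarrow> 'b set" where
  "endpoints l r S i = (\<lambda>s. l s i) ` S \<union> (\<lambda>s. r s i) ` S"

text \<open>Two copies \<open>f ` B\<close> and \<open>g ` B\<close> of the cluster \<open>B\<close>, with common points \<open>p\<close> and \<open>p'\<close>, have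
  the same position relative to the endpoints of the boxes of \<open>S\<close>. Within its cell, every box of
  \<open>f ` B\<close> is shrunk towards \<open>p\<close>; then \<open>B\<close> is placed like \<open>f ` B\<close>, but with \<open>p\<close> moved slightly
  towards \<open>p'\<close>: whatever separates \<open>f ` B\<close> from \<open>g ` B\<close> then separates \<open>f ` B\<close> from \<open>B\<close>.\<close>

locale parallel_copies =
  fixes A S B :: "'a set" and E :: "'a \<Rightarrow> 'a \<Rightarrow> bool"
    and d :: nat and l r :: "'a \<Rightarrow> nat \<Rightarrow> real"
    and f g :: "'a \<Rightarrow> 'a" and p p' :: "nat \<Rightarrow> real"
  assumes finite_A: "finite A" and S_subset: "S \<subseteq> A" and B_disjoint: "B \<inter> A = {}"
    and E_commute: "\<And>u v. E u v \<longleftrightarrow> E v u"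
    and E_iff: "\<And>u v. u \<in> A \<Longrightarrow> v \<in> A \<Longrightarrow> E u v \<longleftrightarrow> boxes_meet d l r u v"
    and f_in: "\<And>b. b \<in> B \<Longrightarrow> f b \<in> A - S" and g_in: "\<And>b. b \<in> B \<Longrightarrow> g b \<in> A"
    and clique: "\<And>b b'. b \<in> B \<Longrightarrow> b' \<in> B \<Longrightarrow> E b b'"
    and f_g_apart: "\<And>b b'. b \<in> B \<Longrightarrow> b' \<in> B \<Longrightarrow> \<not> E (f b) (g b')"
    and f_isolated: "\<And>b x. b \<in> B \<Longrightarrow> x \<in> A - S - f ` B \<Longrightarrow> \<not> E (f b) x"
    and B_isolated: "\<And>b x. b \<in> B \<Longrightarrow> x \<in> A - S \<Longrightarrow> \<not> E b x"
    and f_neighbours: "\<And>b s. b \<in> B \<Longrightarrow> s \<in> S \<Longrightarrow> E (f b) s \<longleftrightarrow> E b s"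
    and p_in: "\<And>b i. b \<in> B \<Longrightarrow> i < d \<Longrightarrow> l (f b) i \<le> p i \<and> p i \<le> r (f b) i"
    and p'_in: "\<And>b i. b \<in> B \<Longrightarrow> i < d \<Longrightarrow> l (g b) i \<le> p' i \<and> p' i \<le> r (g b) i"
    and same_position: "\<And>b i. b \<in> B \<Longrightarrow> i < d \<Longrightarrow> same_position (endpoints l r S i)
      (l (f b) i) (p i) (r (f b) i) (l (g b) i) (p' i) (r (g b) i)"
begin

definition near :: "nat \<Rightarrow> real" where
  "near i = (SOME z. (p i = p' i \<longrightarrow> z = p i) \<and> (p i < p' i \<longrightarrow> p i < z \<and> z < p' i) \<and>
     (p' i < p i \<longrightarrow> p' i < z \<and> z < p i) \<and>
     (\<forall>y\<in>(\<lambda>x. l x i) ` A \<union> (\<lambda>x. r x i) ` A. (y < p i \<longrightarrow> y < z) \<and> (p i < y \<longrightarrow> z < y)))"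

lemma near_between:
  "p i = p' i \<Longrightarrow> near i = p i" "p i < p' i \<Longrightarrow> p i < near i \<and> near i < p' i"
  "p' i < p i \<Longrightarrow> p' i < near i \<and> near i < p i"
  and less_near: "x \<in> A \<Longrightarrow> r x i < p i \<Longrightarrow> r x i < near i"
  and near_less: "x \<in> A \<Longrightarrow> p i < l x i \<Longrightarrow> near i < l x i"
  using someI_ex[OF exists_near_towards[of "(\<lambda>x. l x i) ` A \<union> (\<lambda>x. r x i) ` A" "p i" "p' i"]]
    finite_A unfolding near_def[symmetric] by blast+

definition model :: "'a \<Rightarrow> 'a" where
  "model u = (if u \<in> B then f u else u)"

definition centre :: "'a \<Rightarrow> nat \<Rightarrow> real" where
  "centre u i = (if u \<in> B then near i else p i)"

definition new_l :: "'a \<Rightarrow> nat \<Rightarrow> real" where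
  "new_l u i = (if u \<in> B \<union> f ` B
     then shrink_left (endpoints l r S i) (p i) (centre u i) (l (model u) i) else l u i)"

definition new_r :: "'a \<Rightarrow> nat \<Rightarrow> real" where
  "new_r u i = (if u \<in> B \<union> f ` B
     then shrink_right (endpoints l r S i) (p i) (centre u i) (r (model u) i) else r u i)"

lemma f_image_subset: "f ` B \<subseteq> A - S"
  using f_in by blast

lemma model_in: "u \<in> B \<union> f ` B \<Longrightarrow> model u \<in> f ` B"
  using B_disjoint f_in by (auto simp: model_def)

lemma model_contains_p: "u \<in> B \<union> f ` B \<Longrightarrow> i < d \<Longrightarrow> l (model u) i \<le> p i \<and> p i \<le> r (model u) i"
  using model_in[of u] p_in by auto

lemma same_cell_centre:
  assumes "u \<in> B \<union> f ` B" "i < d"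
  shows "same_cell (endpoints l r S i) (p i) (centre u i)"
proof -
  obtain b where "b \<in> B" using assms(1) by blast
  then have "same_cell (endpoints l r S i) (p i) (p' i)"
    using same_position assms(2) unfolding same_position_def by blast
  moreover have "p i \<le> near i \<and> near i \<le> p' i \<or> p' i \<le> near i \<and> near i \<le> p i"
    using near_between[of i] by (cases "p i" "p' i" rule: linorder_cases) auto
  ultimately have "same_cell (endpoints l r S i) (p i) (near i)" by (rule same_cell_between)
  then show ?thesis by (simp add: centre_def same_cell_refl)
qed

lemma new_contains_centre:
  "u \<in> B \<union> f ` B \<Longrightarrow> i < d \<Longrightarrow> new_l u i \<le> centre u i \<and> centre u i \<le> new_r u i"
  using shrink_left_le[OF same_cell_centre] le_shrink_right[OF same_cell_centre]
  by (simp add: new_l_def new_r_def)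

lemma endpoints_in: "s \<in> S \<Longrightarrow> l s i \<in> endpoints l r S i" "s \<in> S \<Longrightarrow> r s i \<in> endpoints l r S i"
  by (auto simp: endpoints_def)

lemma meet_old:
  assumes "u \<in> A - f ` B" "v \<in> A - f ` B"
  shows "E u v \<longleftrightarrow> boxes_meet d new_l new_r u v"
proof -
  have "u \<notin> B \<union> f ` B" "v \<notin> B \<union> f ` B" using assms B_disjoint by auto
  then show ?thesis using assms E_iff by (simp add: boxes_meet_def new_l_def new_r_def)
qed

lemma meet_S:
  assumes u: "u \<in> B \<union> f ` B" and s: "s \<in> S"
  shows "E u s \<longleftrightarrow> boxes_meet d new_l new_r u s"
proof -
  have old: "s \<notin> B \<union> f ` B" using s f_image_subset S_subset B_disjoint by auto
  have "E u s \<longleftrightarrow> E (model u) s" using u s f_neighbours by (auto simp: model_def)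
  also have "\<dots> \<longleftrightarrow> boxes_meet d l r (model u) s"
    using E_iff model_in[OF u] f_image_subset S_subset s by auto
  also have "\<dots> \<longleftrightarrow> boxes_meet d new_l new_r u s"
    using shrink_left_le_iff[OF same_cell_centre[OF u] _ endpoints_in(2)[OF s]]
      le_shrink_right_iff[OF same_cell_centre[OF u] _ endpoints_in(1)[OF s]]
      model_contains_p[OF u] u old
    by (simp add: boxes_meet_def new_l_def new_r_def)
  finally show ?thesis .
qed

lemma meet_isolated:
  assumes u: "u \<in> B \<union> f ` B" and v: "v \<in> A - S - f ` B"
  shows "E u v \<longleftrightarrow> boxes_meet d new_l new_r u v"
proof -
  have old: "v \<notin> B \<union> f ` B" using v B_disjoint by auto
  have "\<not> E u v" using u v B_isolated f_isolated by auto
  have "\<not> E (model u) v" using model_in[OF u] v f_isolated by auto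
  then obtain i where i: "i < d" "r v i < l (model u) i \<or> r (model u) i < l v i"
    using E_iff[of "model u" v] model_in[OF u] f_image_subset v
    by (auto simp: boxes_meet_def not_le)
  have "r v i < new_l u i \<or> new_r u i < l v i"
    using i(2) model_contains_p[OF u i(1)] u v less_near[of v i] near_less[of v i]
    by (auto simp: new_l_def new_r_def centre_def intro: less_shrink_left shrink_right_less)
  then have "\<not> boxes_meet d new_l new_r u v"
    using i(1) old by (auto simp: boxes_meet_def new_l_def new_r_def not_le)
  with \<open>\<not> E u v\<close> show ?thesis by simp
qed

lemma meet_clique:
  assumes "u \<in> B \<and> v \<in> B \<or> u \<in> f ` B \<and> v \<in> f ` B"
  shows "E u v \<longleftrightarrow> boxes_meet d new_l new_r u v"
proof -
  have new: "u \<in> B \<union> f ` B" "v \<in> B \<union> f ` B" using assms by auto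
  have "E u v"
  proof (cases "u \<in> B \<and> v \<in> B")
    case False
    then obtain b b' where b: "b \<in> B" "u = f b" "b' \<in> B" "v = f b'" using assms by blast
    have "l u i \<le> r v i \<and> l v i \<le> r u i" if "i < d" for i
      using p_in[OF b(1) that] p_in[OF b(3) that] b(2,4) by simp
    then show ?thesis using E_iff f_in b by (simp add: boxes_meet_def)
  qed (use clique in simp)
  moreover have "boxes_meet d new_l new_r u v"
  proof -
    have "centre u = centre v" using assms B_disjoint f_in unfolding centre_def by fastforce
    then have "new_l u i \<le> new_r v i \<and> new_l v i \<le> new_r u i" if "i < d" for i
      using new_contains_centre[OF new(1) that] new_contains_centre[OF new(2) that] by auto
    then show ?thesis by (simp add: boxes_meet_def)
  qed
  ultimately show ?thesis by simp
qed

lemma meet_copy: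
  assumes u: "u \<in> B" and v: "v \<in> f ` B"
  shows "E u v \<longleftrightarrow> boxes_meet d new_l new_r u v"
proof -
  obtain b where b: "b \<in> B" "v = f b" using v by blast
  have v_old: "v \<notin> B" using v f_in B_disjoint by auto
  have "\<not> E u v" using B_isolated u v f_in by auto
  have "\<not> boxes_meet d l r v (g u)" using f_g_apart[OF b(1) u] E_iff f_in g_in u b by auto
  then obtain i where i: "i < d" "r v i < l (g u) i \<or> r (g u) i < l v i"
    unfolding boxes_meet_def by (auto simp: not_le)
  have cell: "same_cell (endpoints l r S i) (p i) (p' i)"
    "same_cell (endpoints l r S i) (p' i) (p i)"
    using same_position[OF u i(1)] same_cell_sym by (auto simp: same_position_def)
  have v_p: "l v i \<le> p i" "p i \<le> r v i" using p_in b i(1) by auto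
  have g_p': "l (g u) i \<le> p' i" "p' i \<le> r (g u) i" using p'_in u i(1) by auto
  from i(2) have "new_r v i < new_l u i \<or> new_r u i < new_l v i"
  proof
    assume less: "r v i < l (g u) i"
    from same_cell_gap[OF cell(1) v_p(2) less g_p'(1)] same_position[OF u i(1)]
    have "new_r v i = p i" "new_l u i = near i"
      using u v v_old by (auto simp: new_l_def new_r_def shrink_left_def shrink_right_def
          same_position_def model_def centre_def)
    then show ?thesis using near_between(2)[of i] v_p g_p' less by simp
  next
    assume less: "r (g u) i < l v i"
    from same_cell_gap[OF cell(2) g_p'(2) less v_p(1)] same_position[OF u i(1)]
    have "new_l v i = p i" "new_r u i = near i"
      using u v v_old by (auto simp: new_l_def new_r_def shrink_left_def shrink_right_def
          same_position_def model_def centre_def)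
    then show ?thesis using near_between(3)[of i] v_p g_p' less by simp
  qed
  then have "\<not> boxes_meet d new_l new_r u v" using i(1) by (auto simp: boxes_meet_def not_le)
  with \<open>\<not> E u v\<close> show ?thesis by simp
qed

theorem box_representable_add: "box_representable (A \<union> B) E d"
proof (rule box_representableI)
  fix u v assume uv: "u \<in> A \<union> B" "v \<in> A \<union> B"
  have mixed: "E x y \<longleftrightarrow> boxes_meet d new_l new_r x y" if "x \<in> B \<union> f ` B" "y \<in> A - f ` B" for x y
    using that meet_S[of x y] meet_isolated[of x y] by blast
  consider "u \<in> A - f ` B" "v \<in> A - f ` B" | "u \<in> B \<union> f ` B" "v \<in> A - f ` B"
    | "v \<in> B \<union> f ` B" "u \<in> A - f ` B" | "u \<in> B \<and> v \<in> B \<or> u \<in> f ` B \<and> v \<in> f ` B"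
    | "u \<in> B" "v \<in> f ` B" | "v \<in> B" "u \<in> f ` B"
    using uv by blast
  then show "E u v \<longleftrightarrow> boxes_meet d new_l new_r u v"
    using meet_old mixed meet_clique meet_copy E_commute[of u v]
      boxes_meet_commute[of d new_l new_r u v]
    by cases blast+
qed

end

lemma pigeonhole_predicates:
  assumes "finite K" "2 ^ card K < card J"
  obtains j j' where "j \<in> J" "j' \<in> J" "j \<noteq> j'" "\<And>k. k \<in> K \<Longrightarrow> Q j k \<longleftrightarrow> Q j' k"
proof -
  let ?pattern = "\<lambda>j. {k \<in> K. Q j k}"
  have "card (?pattern ` J) \<le> card (Pow K)" using assms(1) by (intro card_mono) auto
  then have "\<not> inj_on ?pattern J" using assms by (intro pigeonhole) (simp add: card_Pow)
  then show thesis using that unfolding inj_on_def by blast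
qed

lemma exists_same_position_pair:
  fixes l r :: "'a \<Rightarrow> nat \<Rightarrow> 'b::linorder" and \<phi> :: "'j \<Rightarrow> 'a \<Rightarrow> 'a" and p :: "'j \<Rightarrow> nat \<Rightarrow> 'b"
  assumes "finite S" "finite B" and many: "2 ^ ((2 * card B + 4 * card S) * d) < card J"
  obtains j j' where "j \<in> J" "j' \<in> J" "j \<noteq> j'"
    and "\<And>b i. b \<in> B \<Longrightarrow> i < d \<Longrightarrow> same_position (endpoints l r S i)
      (l (\<phi> j b) i) (p j i) (r (\<phi> j b) i) (l (\<phi> j' b) i) (p j' i) (r (\<phi> j' b) i)"
proof -
  define profile where "profile j = case_sum
    (\<lambda>(b, i, left). if left then endpoints l r S i \<inter> {l (\<phi> j b) i..p j i} = {}
       else endpoints l r S i \<inter> {p j i..r (\<phi> j b) i} = {})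
    (\<lambda>(s, i, left, below). let y = if left then l s i else r s i
       in if below then y \<le> p j i else p j i \<le> y)" for j
  define K :: "('a \<times> nat \<times> bool + 'a \<times> nat \<times> bool \<times> bool) set"
    where "K = B \<times> {..<d} \<times> UNIV <+> S \<times> {..<d} \<times> UNIV \<times> UNIV"
  have "finite K" "card K = (2 * card B + 4 * card S) * d"
    using assms(1,2) by (simp_all add: K_def card_Plus card_cartesian_product distrib_right
        del: UNIV_Times_UNIV)
  then obtain j j' where j: "j \<in> J" "j' \<in> J" "j \<noteq> j'"
    and same_profile: "\<And>k. k \<in> K \<Longrightarrow> profile j k \<longleftrightarrow> profile j' k"
    using pigeonhole_predicates[of K J profile] many by metis
  have "same_cell (endpoints l r S i) (p j i) (p j' i)" if "i < d" for i
    unfolding same_cell_def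
  proof
    fix y assume "y \<in> endpoints l r S i"
    then obtain s left where "s \<in> S" "y = (if left then l s i else r s i)"
      unfolding endpoints_def by (metis (full_types) UnE imageE)
    then show "(y \<le> p j i \<longleftrightarrow> y \<le> p j' i) \<and> (p j i \<le> y \<longleftrightarrow> p j' i \<le> y)"
      using same_profile[of "Inr (s, i, left, True)"] same_profile[of "Inr (s, i, left, False)"]
        that by (simp add: profile_def K_def InrI)
  qed
  moreover have "(endpoints l r S i \<inter> {l (\<phi> j b) i..p j i} = {} \<longleftrightarrow>
        endpoints l r S i \<inter> {l (\<phi> j' b) i..p j' i} = {}) \<and>
      (endpoints l r S i \<inter> {p j i..r (\<phi> j b) i} = {} \<longleftrightarrow>
        endpoints l r S i \<inter> {p j' i..r (\<phi> j' b) i} = {})" if "b \<in> B" "i < d" for b i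
    using same_profile[of "Inl (b, i, True)"] same_profile[of "Inl (b, i, False)"] that
    by (simp add: profile_def K_def InlI)
  ultimately show thesis by (intro that[OF j]) (simp add: same_position_def)
qed

theorem box_representable_add_cluster_copy:
  fixes E :: "'a \<Rightarrow> 'a \<Rightarrow> bool" and \<phi> :: "'j \<Rightarrow> 'a \<Rightarrow> 'a"
  assumes fin: "finite A" "finite B" and S_subset: "S \<subseteq> A" and B_disjoint: "B \<inter> A = {}"
    and E_commute: "\<And>u v. E u v \<longleftrightarrow> E v u"
    and \<phi>_in: "\<And>j b. j \<in> J \<Longrightarrow> b \<in> B \<Longrightarrow> \<phi> j b \<in> A - S"
    and \<phi>_clique: "\<And>j b b'. j \<in> J \<Longrightarrow> b \<in> B \<Longrightarrow> b' \<in> B \<Longrightarrow> E (\<phi> j b) (\<phi> j b')"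
    and clique: "\<And>b b'. b \<in> B \<Longrightarrow> b' \<in> B \<Longrightarrow> E b b'"
    and \<phi>_apart: "\<And>j j' b b'. j \<in> J \<Longrightarrow> j' \<in> J \<Longrightarrow> j \<noteq> j' \<Longrightarrow> b \<in> B \<Longrightarrow> b' \<in> B \<Longrightarrow> \<not> E (\<phi> j b) (\<phi> j' b')"
    and \<phi>_isolated: "\<And>j b x. j \<in> J \<Longrightarrow> b \<in> B \<Longrightarrow> x \<in> A - S - \<phi> j ` B \<Longrightarrow> \<not> E (\<phi> j b) x"
    and B_isolated: "\<And>b x. b \<in> B \<Longrightarrow> x \<in> A - S \<Longrightarrow> \<not> E b x"
    and \<phi>_neighbours: "\<And>j b s. j \<in> J \<Longrightarrow> b \<in> B \<Longrightarrow> s \<in> S \<Longrightarrow> E (\<phi> j b) s \<longleftrightarrow> E b s"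
    and many: "2 ^ ((2 * card B + 4 * card S) * d) < card J"
    and rep: "box_representable A E d"
  shows "box_representable (A \<union> B) E d"
proof -
  obtain l r :: "'a \<Rightarrow> nat \<Rightarrow> real"
    where E_iff: "\<forall>u\<in>A. \<forall>v\<in>A. E u v \<longleftrightarrow> boxes_meet d l r u v"
    using rep unfolding box_representable_def by blast
  define p where "p j i = Max ((\<lambda>b. l (\<phi> j b) i) ` B)" for j i
  have "l (\<phi> j b) i \<le> r (\<phi> j b') i" if "j \<in> J" "b \<in> B" "b' \<in> B" "i < d" for j b b' i
    using that \<phi>_clique[of j b b'] E_iff \<phi>_in[of j] by (auto simp: boxes_meet_def)
  then have p_in: "l (\<phi> j b) i \<le> p j i \<and> p j i \<le> r (\<phi> j b) i" if "j \<in> J" "b \<in> B" "i < d" for j b i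
    unfolding p_def using that fin(2) by (intro conjI Max_ge Max.boundedI) auto
  have "finite S" using fin(1) S_subset finite_subset by blast
  then obtain j j' where j: "j \<in> J" "j' \<in> J" "j \<noteq> j'"
    and same_position: "\<And>b i. b \<in> B \<Longrightarrow> i < d \<Longrightarrow> same_position (endpoints l r S i)
      (l (\<phi> j b) i) (p j i) (r (\<phi> j b) i) (l (\<phi> j' b) i) (p j' i) (r (\<phi> j' b) i)"
    by (rule exists_same_position_pair[OF _ fin(2) many, where l = l and r = r and \<phi> = \<phi> and p = p])
      (rule that; assumption)
  have \<phi>_j'_in: "\<phi> j' b \<in> A" if "b \<in> B" for b using \<phi>_in[OF j(2) that] by simp
  interpret parallel_copies A S B E d l r "\<phi> j" "\<phi> j'" "p j" "p j'"
    by unfold_locales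
      (fact fin S_subset B_disjoint E_commute E_iff[rule_format] \<phi>_in[OF j(1)] \<phi>_j'_in clique
        \<phi>_apart[OF j] \<phi>_isolated[OF j(1)] B_isolated \<phi>_neighbours[OF j(1)] p_in[OF j(1)]
        p_in[OF j(2)] same_position)+
  show ?thesis by (rule box_representable_add)
qed

section \<open>Reduction to a bounded number of vertices\<close>

definition copies_bound :: "nat \<Rightarrow> nat \<Rightarrow> nat" where
  "copies_bound k d = 2 ^ ((2 * 2 ^ k + 4 * k) * d)"

locale cluster_modulator =
  fixes V S :: "'a::wellorder set" and E :: "'a \<Rightarrow> 'a \<Rightarrow> bool"
  assumes finite_V: "finite V" and S_subset: "S \<subseteq> V"
    and E_commute: "E u v \<longleftrightarrow> E v u"
    and E_refl: "E v v"
    and E_trans: "u \<in> V - S \<Longrightarrow> v \<in> V - S \<Longrightarrow> w \<in> V - S \<Longrightarrow> E u v \<Longrightarrow> E v w \<Longrightarrow> E u w"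
begin

definition cluster :: "'a \<Rightarrow> 'a set" where
  "cluster v = {u \<in> V - S. E u v}"

definition nbh :: "'a \<Rightarrow> 'a set" where
  "nbh v = {w \<in> S. E v w}"

definition types :: "'a \<Rightarrow> 'a set set" where
  "types v = nbh ` cluster v"

definition leader :: "'a \<Rightarrow> bool" where
  "leader c \<longleftrightarrow> c \<in> V - S \<and> (\<forall>u\<in>cluster c. c \<le> u)"

definition first_twin :: "'a \<Rightarrow> bool" where
  "first_twin v \<longleftrightarrow> v \<in> V - S \<and> (\<forall>u\<in>cluster v. nbh u = nbh v \<longrightarrow> v \<le> u)"

definition reduced :: "'a \<Rightarrow> 'a set" where
  "reduced c = {v \<in> cluster c. first_twin v}"

definition earlier :: "'a \<Rightarrow> 'a set" where
  "earlier c = {c'. c' < c \<and> leader c' \<and> types c' = types c}"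

definition restriction :: "'a set \<Rightarrow> 'a set" where
  "restriction X = S \<union> (\<Union>c\<in>X. reduced c)"

definition kept :: "nat \<Rightarrow> 'a set" where
  "kept N = restriction {c. leader c \<and> card (earlier c) \<le> N}"

lemma finite_S: "finite S"
  using S_subset finite_V by (rule finite_subset)

lemma cluster_subset: "cluster v \<subseteq> V - S"
  by (auto simp: cluster_def)

lemma reduced_subset: "reduced c \<subseteq> V - S"
  using cluster_subset by (auto simp: reduced_def)

lemma nbh_in_types: "v \<in> reduced c \<Longrightarrow> nbh v \<in> types c"
  by (auto simp: reduced_def types_def)

lemma nbh_subset: "nbh v \<subseteq> S"
  by (auto simp: nbh_def)

lemma restriction_subset: "restriction X \<subseteq> V"
  using S_subset cluster_subset by (auto simp: restriction_def reduced_def)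

lemma restriction_insert: "restriction (insert c X) = restriction X \<union> reduced c"
  by (auto simp: restriction_def)

lemma finite_leaders: "finite {c. leader c}"
  by (rule finite_subset[OF _ finite_V]) (auto simp: leader_def)

lemma leader_in: "leader c \<Longrightarrow> c \<in> V - S"
  by (simp add: leader_def)

lemma in_cluster_self: "v \<in> V - S \<Longrightarrow> v \<in> cluster v"
  using E_refl by (simp add: cluster_def)

lemma E_iff_cluster_eq:
  assumes "u \<in> V - S" "v \<in> V - S"
  shows "E u v \<longleftrightarrow> cluster u = cluster v"
proof
  assume "E u v"
  then show "cluster u = cluster v"
    unfolding cluster_def using assms E_trans[of _ u v] E_trans[of _ v u] E_commute[of u v] by blast
next
  assume "cluster u = cluster v"
  then show "E u v" using in_cluster_self[OF assms(1)] by (simp add: cluster_def)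
qed

lemma in_cluster_iff: "v \<in> V - S \<Longrightarrow> u \<in> cluster v \<longleftrightarrow> u \<in> V - S \<and> cluster u = cluster v"
  using E_iff_cluster_eq by (auto simp: cluster_def)

lemma leader_exists:
  assumes "v \<in> V - S"
  obtains c where "leader c" "cluster c = cluster v"
proof -
  let ?c = "LEAST u. u \<in> cluster v"
  have "?c \<in> cluster v" using in_cluster_self[OF assms] by (rule LeastI)
  moreover from this have "cluster ?c = cluster v" using assms in_cluster_iff by blast
  moreover have "?c \<le> u" if "u \<in> cluster v" for u using that by (rule Least_le)
  ultimately show thesis using cluster_subset that unfolding leader_def by blast
qed

lemma leader_unique: "leader c \<Longrightarrow> leader c' \<Longrightarrow> cluster c = cluster c' \<Longrightarrow> c = c'"
  unfolding leader_def using in_cluster_self by (metis order.antisym)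

lemma reduced_clique:
  assumes "c \<in> V - S" "u \<in> reduced c" "v \<in> reduced c"
  shows "E u v"
  using assms in_cluster_iff E_iff_cluster_eq by (auto simp: reduced_def)

lemma reduced_apart:
  assumes "leader c" "leader c'" "c \<noteq> c'" "u \<in> reduced c" "v \<in> reduced c'"
  shows "\<not> E u v"
  using assms leader_unique leader_in in_cluster_iff E_iff_cluster_eq
  unfolding reduced_def by (metis (no_types, lifting) mem_Collect_eq)

lemma bij_betw_nbh_reduced:
  assumes "c \<in> V - S"
  shows "bij_betw nbh (reduced c) (types c)"
  unfolding bij_betw_def
proof
  show "inj_on nbh (reduced c)"
  proof (rule inj_onI)
    fix u v assume "u \<in> reduced c" "v \<in> reduced c" "nbh u = nbh v"
    then have "u \<in> cluster v" "v \<in> cluster u" "first_twin u" "first_twin v"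
      using assms in_cluster_iff by (auto simp: reduced_def)
    with \<open>nbh u = nbh v\<close> show "u = v" unfolding first_twin_def by (metis order.antisym)
  qed
  show "nbh ` reduced c = types c"
  proof
    show "types c \<subseteq> nbh ` reduced c"
    proof
      fix X assume "X \<in> types c"
      let ?P = "\<lambda>u. u \<in> cluster c \<and> nbh u = X"
      have "\<exists>u. ?P u" using \<open>X \<in> types c\<close> by (auto simp: types_def)
      then have least: "?P (LEAST u. ?P u)" by (rule LeastI_ex)
      then have "cluster (LEAST u. ?P u) = cluster c" using assms in_cluster_iff by blast
      then have "first_twin (LEAST u. ?P u)"
        using least cluster_subset Least_le[of ?P] unfolding first_twin_def by blast
      then show "X \<in> nbh ` reduced c" using least by (auto simp: reduced_def)
    qed
  qed (auto simp: reduced_def types_def)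
qed

lemma card_reduced_le:
  assumes "c \<in> V - S"
  shows "card (reduced c) \<le> 2 ^ card S"
proof -
  have "card (reduced c) = card (types c)"
    using bij_betw_nbh_reduced[OF assms] by (rule bij_betw_same_card)
  also have "\<dots> \<le> card (Pow S)"
    using finite_S nbh_subset by (intro card_mono) (auto simp: types_def)
  finally show ?thesis using finite_S by (simp add: card_Pow)
qed

definition twin :: "'a \<Rightarrow> 'a \<Rightarrow> 'a" where
  "twin c v = inv_into (reduced c) nbh (nbh v)"

lemma
  assumes "c \<in> V - S" "nbh v \<in> types c"
  shows twin_in_reduced: "twin c v \<in> reduced c" and nbh_twin: "nbh (twin c v) = nbh v"
  using assms bij_betw_nbh_reduced[OF assms(1)] unfolding twin_def bij_betw_def
  by (metis inv_into_into, metis f_inv_into_f)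

lemma twin_image_reduced:
  assumes "c \<in> V - S" "c' \<in> V - S" "types c = types c'"
  shows "twin c' ` reduced c = reduced c'"
proof -
  have "twin c' ` reduced c = inv_into (reduced c') nbh ` nbh ` reduced c"
    by (auto simp: twin_def)
  also have "nbh ` reduced c = types c'"
    using bij_betw_nbh_reduced[OF assms(1)] assms(3) by (simp add: bij_betw_def)
  finally show ?thesis
    using bij_betw_inv_into[OF bij_betw_nbh_reduced[OF assms(2)]] by (simp add: bij_betw_def)
qed

lemma box_representable_restriction_leaders:
  assumes "box_representable (restriction {c. leader c}) E d"
  shows "box_representable V E d"
proof -
  define t where "t v = (if v \<in> S then v else twin v v)" for v
  have t_S: "t v = v" if "v \<in> S" for v using that by (simp add: t_def)
  have t_reduced: "t v \<in> reduced v" and nbh_t: "nbh (t v) = nbh v" if "v \<in> V - S" for v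
    using that in_cluster_self twin_in_reduced[of v v] nbh_twin[of v v]
    by (auto simp: t_def types_def)
  then have cluster_t: "t v \<in> V - S" "cluster (t v) = cluster v" if "v \<in> V - S" for v
    using that in_cluster_iff by (auto simp: reduced_def)
  have mixed: "E u v \<longleftrightarrow> E (t u) (t v)" if "u \<in> V - S" "v \<in> S" for u v
    using that nbh_t[of u] t_S by (auto simp: nbh_def)
  have "E u v \<longleftrightarrow> E (t u) (t v)" if uv: "u \<in> V" "v \<in> V" for u v
  proof -
    consider "u \<in> S" "v \<in> S" | "u \<in> V - S" "v \<in> S" | "u \<in> S" "v \<in> V - S"
      | "u \<in> V - S" "v \<in> V - S" using uv by blast
    then show ?thesis
    proof cases
      case 3
      then show ?thesis using mixed[of v u] E_commute by blast
    next
      case 4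
      then show ?thesis using cluster_t by (simp add: E_iff_cluster_eq)
    qed (use t_S mixed in auto)
  qed
  moreover have "t v \<in> restriction {c. leader c}" if v: "v \<in> V" for v
  proof (cases "v \<in> S")
    case False
    then obtain c where "leader c" "cluster c = cluster v" using v leader_exists[of v] by blast
    then have "t v \<in> reduced c" using t_reduced[of v] False v by (simp add: reduced_def)
    then show ?thesis using \<open>leader c\<close> by (auto simp: restriction_def)
  qed (simp add: t_S restriction_def)
  ultimately show ?thesis using box_representable_vimage[OF assms, of t V E] by blast
qed

lemma reduced_isolated:
  assumes "leader c" "X \<subseteq> {c. leader c} - {c}" "b \<in> reduced c" "x \<in> restriction X - S"
  shows "\<not> E b x"
  using assms reduced_apart[OF assms(1)] by (auto simp: restriction_def)

lemma box_representable_insert_cluster: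
  assumes X: "X \<subseteq> {c. leader c}" and c: "leader c" "c \<notin> X" and earlier: "earlier c \<subseteq> X"
    and many: "copies_bound (card S) d < card (earlier c)"
    and rep: "box_representable (restriction X) E d"
  shows "box_representable (restriction (insert c X)) E d"
  unfolding restriction_insert
proof (rule box_representable_add_cluster_copy[where S = S and J = "earlier c" and \<phi> = twin,
      OF _ _ _ _ E_commute])
  have j: "leader j" "j \<in> X" "types j = types c" if "j \<in> earlier c" for j
    using that earlier by (auto simp: earlier_def)
  have twin: "twin j b \<in> reduced j" "nbh (twin j b) = nbh b"
    if "j \<in> earlier c" "b \<in> reduced c" for j b
    using j[OF that(1)] nbh_in_types[OF that(2)] leader_in twin_in_reduced nbh_twin by auto
  show "finite (restriction X)" using restriction_subset finite_V by (rule finite_subset)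
  show "finite (reduced c)" using reduced_subset finite_V by (meson finite_Diff finite_subset)
  show "S \<subseteq> restriction X" by (auto simp: restriction_def)
  show new: "\<not> E b x" if "b \<in> reduced c" "x \<in> restriction X - S" for b x
    by (rule reduced_isolated[OF c(1) _ that]) (use X c(2) in auto)
  then show "reduced c \<inter> restriction X = {}" using E_refl reduced_subset by blast
  show "twin j b \<in> restriction X - S" if "j \<in> earlier c" "b \<in> reduced c" for j b
    using twin[OF that] j[OF that(1)] reduced_subset by (auto simp: restriction_def)
  show "E (twin j b) (twin j b')" if "j \<in> earlier c" "b \<in> reduced c" "b' \<in> reduced c" for j b b'
    by (rule reduced_clique[OF leader_in[OF j(1)] twin(1) twin(1)]) (rule that)+
  show "E b b'" if "b \<in> reduced c" "b' \<in> reduced c" for b b'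
    by (rule reduced_clique[OF leader_in[OF c(1)] that])
  show "\<not> E (twin j b) (twin j' b')"
    if "j \<in> earlier c" "j' \<in> earlier c" "j \<noteq> j'" "b \<in> reduced c" "b' \<in> reduced c" for j j' b b'
    by (rule reduced_apart[OF j(1) j(1) _ twin(1) twin(1)]) (rule that)+
  show "\<not> E (twin j b) x"
    if jb: "j \<in> earlier c" "b \<in> reduced c" and x: "x \<in> restriction X - S - twin j ` reduced c"
    for j b x
  proof (rule reduced_isolated[OF j(1)[OF jb(1)] _ twin(1)[OF jb]])
    have "twin j ` reduced c = reduced j"
      using twin_image_reduced c(1) j[OF jb(1)] leader_in by metis
    then show "x \<in> restriction (X - {j}) - S" using x by (auto simp: restriction_def)
  qed (use X in auto)
  show "E (twin j b) s \<longleftrightarrow> E b s" if "j \<in> earlier c" "b \<in> reduced c" "s \<in> S" for j b s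
    using twin(2)[OF that(1,2)] that(3) by (auto simp: nbh_def)
  have "2 ^ ((2 * card (reduced c) + 4 * card S) * d) \<le> copies_bound (card S) d"
    using card_reduced_le[OF leader_in[OF c(1)]] unfolding copies_bound_def
    by (intro power_increasing mult_le_mono1) auto
  then show "2 ^ ((2 * card (reduced c) + 4 * card S) * d) < card (earlier c)"
    using many by linarith
qed (rule rep)

theorem box_representable_kept_iff:
  assumes "copies_bound (card S) d \<le> N"
  shows "box_representable (kept N) E d \<longleftrightarrow> box_representable V E d"
proof
  show "box_representable V E d \<Longrightarrow> box_representable (kept N) E d"
    using restriction_subset unfolding kept_def by (rule box_representable_subset[rotated])
next
  assume kept: "box_representable (kept N) E d"
  let ?K = "{c. leader c \<and> card (earlier c) \<le> N}"
  have "box_representable (restriction (?K \<union> X)) E d"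
    if "X \<subseteq> {c. leader c}" "\<And>c. c \<in> X \<Longrightarrow> earlier c \<subseteq> X" "finite X" for X
    using that(3,1,2)
  proof (induction X rule: finite_linorder_max_induct)
    case empty
    then show ?case using kept by (simp add: kept_def)
  next
    case (insert c X)
    have c_max: "c' < c" if "c' \<in> X" for c' using insert.hyps(2) that by blast
    have earlier_c: "earlier c \<subseteq> X" using insert.prems(2)[of c] by (auto simp: earlier_def)
    have "earlier c' \<subseteq> X" if "c' \<in> X" for c'
      using insert.prems(2)[of c'] c_max[OF that] that by (auto simp: earlier_def)
    then have IH: "box_representable (restriction (?K \<union> X)) E d" using insert by blast
    show ?case
    proof (cases "c \<in> ?K \<union> X")
      case True
      then show ?thesis using IH by (simp add: insert_absorb)
    next
      case False
      then have "box_representable (restriction (insert c (?K \<union> X))) E d"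
        using insert.prems(1) earlier_c assms by (intro box_representable_insert_cluster IH) auto
      then show ?thesis by simp
    qed
  qed
  from this[of "{c. leader c}"] have "box_representable (restriction {c. leader c}) E d"
    using finite_leaders by (auto simp: earlier_def Un_absorb1 Collect_mono)
  then show "box_representable V E d" by (rule box_representable_restriction_leaders)
qed

lemma card_few_earlier:
  "card {c. leader c \<and> card (earlier c) \<le> N} \<le> 2 ^ 2 ^ card S * (N + 1)" (is "card ?K \<le> _")
proof -
  have "card (earlier c) < card (earlier c')" if "c < c'" "leader c" "types c = types c'" for c c'
    using that finite_subset[OF _ finite_leaders, of "earlier c'"]
    by (intro psubset_card_mono) (auto simp: earlier_def)
  then have "inj_on (\<lambda>c. (types c, card (earlier c))) ?K"
    by (intro inj_onI)
      (metis (mono_tags, lifting) mem_Collect_eq less_irrefl linorder_neqE Pair_inject)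
  moreover have "(\<lambda>c. (types c, card (earlier c))) ` ?K \<subseteq> Pow (Pow S) \<times> {..N}"
    using nbh_subset by (auto simp: types_def)
  moreover have "finite (Pow (Pow S) \<times> {..N})" using finite_S by simp
  ultimately have "card ?K \<le> card (Pow (Pow S) \<times> {..N})" by (rule card_inj_on_le)
  then show ?thesis using finite_S by (simp add: card_cartesian_product card_Pow)
qed

theorem card_kept_le: "card (kept N) \<le> card S + 2 ^ 2 ^ card S * (N + 1) * 2 ^ card S"
proof -
  let ?K = "{c. leader c \<and> card (earlier c) \<le> N}"
  have finite_K: "finite ?K" by (rule finite_subset[OF _ finite_leaders]) auto
  have "card (\<Union>c\<in>?K. reduced c) \<le> (\<Sum>c\<in>?K. card (reduced c))"
    using finite_K by (rule card_UN_le)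
  also have "\<dots> \<le> card ?K * 2 ^ card S"
    using sum_bounded_above[of ?K "\<lambda>c. card (reduced c)" "2 ^ card S"] card_reduced_le leader_in
    by simp
  also have "\<dots> \<le> 2 ^ 2 ^ card S * (N + 1) * 2 ^ card S"
    using card_few_earlier by (rule mult_le_mono1)
  finally have "card (\<Union>c\<in>?K. reduced c) \<le> 2 ^ 2 ^ card S * (N + 1) * 2 ^ card S" .
  then show ?thesis
    using card_Un_le[of S "\<Union>c\<in>?K. reduced c"] unfolding kept_def restriction_def by linarith
qed

theorem box_representable_Suc_card_modulator: "box_representable V E (card S + 1)"
proof -
  have "box_representable V (\<lambda>u v. u = s \<or> v = s \<longrightarrow> E u v) 1" for s
    by (rule box_representable_intervals[where l = "\<lambda>v. if E v s then 0 else 1"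
          and r = "\<lambda>v. if v = s then 0 else 1"]) (use E_commute in auto)
  then have modulator: "box_representable V (\<lambda>u v. \<forall>s\<in>S. u = s \<or> v = s \<longrightarrow> E u v) (card S)"
    using box_representable_Ball[OF finite_S, of V "\<lambda>s u v. u = s \<or> v = s \<longrightarrow> E u v" 1] by simp
  obtain h :: "'a set \<Rightarrow> nat" and n where h: "h ` cluster ` V = {i. i < n}" "inj_on h (cluster ` V)"
    using finite_imp_inj_to_nat_seg[of "cluster ` V"] finite_V by blast
  have bound: "h (cluster v) \<le> n" if "v \<in> V" for v using h(1) that by (blast intro: less_imp_le)
  have E_iff: "E u v \<longleftrightarrow> h (cluster u) = h (cluster v)" if "u \<in> V - S" "v \<in> V - S" for u v
    using that E_iff_cluster_eq[OF that] inj_on_eq_iff[OF h(2)] by simp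
  have clusters: "box_representable V (\<lambda>u v. u \<in> S \<or> v \<in> S \<or> E u v) 1"
    by (rule box_representable_intervals[where l = "\<lambda>v. if v \<in> S then 0 else h (cluster v)"
          and r = "\<lambda>v. if v \<in> S then n else h (cluster v)"])
      (simp add: bound E_iff eq_iff)
  show ?thesis
    by (rule box_representable_vimage[OF box_representable_conj[OF modulator clusters], of "\<lambda>v. v"])
      auto
qed

end

section \<open>Boxicity and cluster vertex deletion\<close>

abbreviation adj_or_eq :: "('a, 'b) pre_digraph \<Rightarrow> 'a \<Rightarrow> 'a \<Rightarrow> bool" where
  "adj_or_eq G u v \<equiv> u = v \<or> u \<rightarrow>\<^bsub>G\<^esub> v"

lemma PiE_intervals_meet_iff:
  fixes l r l' r' :: "'i \<Rightarrow> 'b::linorder"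
  assumes "\<forall>i\<in>I. l i \<le> r i" "\<forall>i\<in>I. l' i \<le> r' i"
  shows "(\<Pi>\<^sub>E i\<in>I. {l i..r i}) \<inter> (\<Pi>\<^sub>E i\<in>I. {l' i..r' i}) \<noteq> {} \<longleftrightarrow>
    (\<forall>i\<in>I. l i \<le> r' i \<and> l' i \<le> r i)"
proof -
  have "(\<Pi>\<^sub>E i\<in>I. {l i..r i}) \<inter> (\<Pi>\<^sub>E i\<in>I. {l' i..r' i}) =
      (\<Pi>\<^sub>E i\<in>I. {max (l i) (l' i)..min (r i) (r' i)})"
    unfolding PiE_Int by simp
  then show ?thesis using assms by (auto simp: PiE_eq_empty_iff)
qed

lemma boxes_meet_iff_PiE:
  fixes l r :: "'a \<Rightarrow> nat \<Rightarrow> 'b::linorder"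
  assumes "\<forall>i<d. l u i \<le> r u i" "\<forall>i<d. l v i \<le> r v i"
  shows "boxes_meet d l r u v \<longleftrightarrow>
    (\<Pi>\<^sub>E i\<in>{..<d}. {l u i..r u i}) \<inter> (\<Pi>\<^sub>E i\<in>{..<d}. {l v i..r v i}) \<noteq> {}"
  using PiE_intervals_meet_iff[of "{..<d}" "l u" "r u" "l v" "r v"] assms
  by (auto simp: boxes_meet_def)

lemma box_representation_iff_box_representable:
  fixes G :: "('a, 'b) pre_digraph"
  shows "(\<exists>B. box_representation G d B) \<longleftrightarrow> box_representable (verts G) (adj_or_eq G) d"
proof
  assume "\<exists>B. box_representation G d B"
  then obtain B where B: "\<And>v. v \<in> verts G \<Longrightarrow> is_box d (B v)"
    "\<And>u v. u \<in> verts G \<Longrightarrow> v \<in> verts G \<Longrightarrow> u \<noteq> v \<Longrightarrow> u \<rightarrow>\<^bsub>G\<^esub> v \<longleftrightarrow> B u \<inter> B v \<noteq> {}"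
    unfolding box_representation_def by blast
  have "\<forall>v. \<exists>l r. v \<in> verts G \<longrightarrow> (\<forall>i<d. l i \<le> r i) \<and> B v = (\<Pi>\<^sub>E i\<in>{..<d}. {l i..r i})"
    using B(1) unfolding is_box_def by blast
  then obtain l r where lr: "\<And>v. v \<in> verts G \<Longrightarrow> \<forall>i<d. l v i \<le> r v i"
    "\<And>v. v \<in> verts G \<Longrightarrow> B v = (\<Pi>\<^sub>E i\<in>{..<d}. {l v i..r v i})" by metis
  have "adj_or_eq G u v \<longleftrightarrow> boxes_meet d l r u v" if "u \<in> verts G" "v \<in> verts G" for u v
    using B(2)[OF that] boxes_meet_iff_PiE[OF lr(1)[OF that(1)] lr(1)[OF that(2)]] lr(1)[OF that(1)]
    by (cases "u = v") (simp_all add: lr(2) that boxes_meet_def)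
  then show "box_representable (verts G) (adj_or_eq G) d" by (rule box_representableI)
next
  assume "box_representable (verts G) (adj_or_eq G) d"
  then obtain l r :: "'a \<Rightarrow> nat \<Rightarrow> real" where
    lr: "\<forall>u\<in>verts G. \<forall>v\<in>verts G. adj_or_eq G u v \<longleftrightarrow> boxes_meet d l r u v"
    unfolding box_representable_def by blast
  have le: "\<forall>i<d. l v i \<le> r v i" if "v \<in> verts G" for v
    using lr that unfolding boxes_meet_def by blast
  have "box_representation G d (\<lambda>v. \<Pi>\<^sub>E i\<in>{..<d}. {l v i..r v i})"
    unfolding box_representation_def
  proof (intro conjI ballI impI)
    fix v assume "v \<in> verts G"
    then show "is_box d (\<Pi>\<^sub>E i\<in>{..<d}. {l v i..r v i})" unfolding is_box_def using le by blast
  next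
    fix u v assume "u \<in> verts G" "v \<in> verts G" "u \<noteq> v"
    then show "u \<rightarrow>\<^bsub>G\<^esub> v \<longleftrightarrow>
        (\<Pi>\<^sub>E i\<in>{..<d}. {l u i..r u i}) \<inter> (\<Pi>\<^sub>E i\<in>{..<d}. {l v i..r v i}) \<noteq> {}"
      using lr[rule_format, of u v] boxes_meet_iff_PiE[where l = l and r = r, OF le le, of u v]
      by simp
  qed
  then show "\<exists>B. box_representation G d B" by blast
qed

lemma boxicity_le_iff:
  assumes "box_representable (verts G) (adj_or_eq G) k"
  shows "boxicity G \<le> d \<longleftrightarrow> box_representable (verts G) (adj_or_eq G) d"
proof
  have "box_representable (verts G) (adj_or_eq G) (boxicity G)"
    unfolding boxicity_def box_representation_iff_box_representable using assms by (rule LeastI)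
  then show "boxicity G \<le> d \<Longrightarrow> box_representable (verts G) (adj_or_eq G) d"
    using box_representable_mono by blast
next
  show "box_representable (verts G) (adj_or_eq G) d \<Longrightarrow> boxicity G \<le> d"
    unfolding boxicity_def box_representation_iff_box_representable by (rule Least_le)
qed

lemma cluster_graph_no_induced_path:
  assumes "cluster_graph G" "u \<rightarrow>\<^bsub>G\<^esub> v" "v \<rightarrow>\<^bsub>G\<^esub> w" "u \<noteq> w"
  shows "u \<rightarrow>\<^bsub>G\<^esub> w"
proof -
  obtain P where P: "partition_on (verts G) P"
    "arcs_ends G = (\<Union>C\<in>P. {(u, v). u \<in> C \<and> v \<in> C \<and> u \<noteq> v})"
    using assms(1) unfolding cluster_graph_def by blast
  then obtain C C' where "C \<in> P" "u \<in> C" "v \<in> C" "C' \<in> P" "v \<in> C'" "w \<in> C'"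
    using assms(2,3) by auto
  moreover from this have "C = C'"
    using partition_onD2[OF P(1)] by (auto simp: disjoint_def)
  ultimately show ?thesis using P(2) assms(4) by auto
qed

lemma cluster_graph_induce_empty: "cluster_graph (G \<restriction> {})"
  unfolding cluster_graph_def
proof
  show "graph (G \<restriction> {})"
    by unfold_locales (auto simp: induce_subgraph_def arcs_ends_def symmetric_def sym_def)
  show "\<exists>P. partition_on (verts (G \<restriction> {})) P \<and>
      arcs_ends (G \<restriction> {}) = (\<Union>C\<in>P. {(u, v). u \<in> C \<and> v \<in> C \<and> u \<noteq> v})"
    by (rule exI[of _ "{}"]) (auto simp: partition_on_def induce_subgraph_def arcs_ends_def)
qed

lemma dominates_induce_iff: "u \<rightarrow>\<^bsub>G \<restriction> W\<^esub> v \<longleftrightarrow> u \<rightarrow>\<^bsub>G\<^esub> v \<and> u \<in> W \<and> v \<in> W"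
  by (auto simp: induce_subgraph_def arcs_ends_def arc_to_ends_def)

lemma (in wf_digraph) cluster_vertex_deletion_set:
  obtains X where "X \<subseteq> verts G" "card X = cluster_vertex_deletion_number G"
    "\<And>u v w. u \<rightarrow>\<^bsub>G\<^esub> v \<Longrightarrow> v \<rightarrow>\<^bsub>G\<^esub> w \<Longrightarrow> u \<noteq> w \<Longrightarrow> \<not> u \<rightarrow>\<^bsub>G\<^esub> w \<Longrightarrow> u \<in> X \<or> v \<in> X \<or> w \<in> X"
proof -
  let ?P = "\<lambda>k. \<exists>S\<subseteq>verts G. card S = k \<and> cluster_graph (G \<restriction> (verts G - S))"
  have "?P (card (verts G))" by (intro exI[of _ "verts G"]) (simp add: cluster_graph_induce_empty)
  then have "?P (cluster_vertex_deletion_number G)"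
    unfolding cluster_vertex_deletion_number_def by (rule LeastI)
  then obtain X where X: "X \<subseteq> verts G" "card X = cluster_vertex_deletion_number G"
    and cluster: "cluster_graph (G \<restriction> (verts G - X))" by blast
  have "u \<in> X \<or> v \<in> X \<or> w \<in> X" if path: "u \<rightarrow>\<^bsub>G\<^esub> v" "v \<rightarrow>\<^bsub>G\<^esub> w" "u \<noteq> w" "\<not> u \<rightarrow>\<^bsub>G\<^esub> w" for u v w
  proof (rule ccontr)
    assume "\<not> (u \<in> X \<or> v \<in> X \<or> w \<in> X)"
    with path(1,2) have "u \<rightarrow>\<^bsub>G \<restriction> (verts G - X)\<^esub> v" "v \<rightarrow>\<^bsub>G \<restriction> (verts G - X)\<^esub> w"
      by (auto simp: dominates_induce_iff adj_in_verts)
    then have "u \<rightarrow>\<^bsub>G \<restriction> (verts G - X)\<^esub> w"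
      using path(3) by (rule cluster_graph_no_induced_path[OF cluster])
    with path(4) show False by (simp add: dominates_induce_iff)
  qed
  with X show thesis by (rule that)
qed

section \<open>Greedy hitting sets\<close>

definition greedy_packing :: "'a set list \<Rightarrow> 'a set \<Rightarrow> 'a set" where
  "greedy_packing Fs = fold (\<lambda>F X. if F \<inter> X = {} then F \<union> X else X) Fs"

lemma greedy_packing_simps [simp]:
  "greedy_packing [] X = X"
  "greedy_packing (F # Fs) X = greedy_packing Fs (if F \<inter> X = {} then F \<union> X else X)"
  by (simp_all add: greedy_packing_def)

lemma greedy_packing_superset: "X \<subseteq> greedy_packing Fs X"
proof (induction Fs arbitrary: X)
  case (Cons F Fs)
  from Cons[of "F \<union> X"] Cons[of X] show ?case by auto
qed simp

lemma greedy_packing_subset: "greedy_packing Fs X \<subseteq> X \<union> \<Union>(set Fs)"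
proof (induction Fs arbitrary: X)
  case (Cons F Fs)
  from Cons[of "F \<union> X"] Cons[of X] show ?case by auto
qed simp

lemma greedy_packing_hits:
  assumes "F \<in> set Fs" "F \<noteq> {}"
  shows "F \<inter> greedy_packing Fs X \<noteq> {}"
  using assms(1)
proof (induction Fs arbitrary: X)
  case (Cons F' Fs)
  show ?case
  proof (cases "F = F'")
    case True
    then show ?thesis
      using assms(2) greedy_packing_superset[of "F \<union> X" Fs] greedy_packing_superset[of X Fs] by auto
  next
    case False
    then show ?thesis using Cons by simp
  qed
qed simp

lemma card_greedy_packing_le_inter:
  assumes "\<And>F. F \<in> set Fs \<Longrightarrow> finite F \<and> card F \<le> k \<and> F \<inter> Y \<noteq> {}"
    and "finite X" "card X \<le> k * card (X \<inter> Y)"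
  shows "card (greedy_packing Fs X) \<le> k * card (greedy_packing Fs X \<inter> Y)"
  using assms
proof (induction Fs arbitrary: X)
  case (Cons F Fs)
  show ?case
  proof (cases "F \<inter> X = {}")
    case True
    have F: "finite F" "card F \<le> k" "F \<inter> Y \<noteq> {}" using Cons.prems(1)[of F] by auto
    have "card ((F \<union> X) \<inter> Y) = card (F \<inter> Y) + card (X \<inter> Y)"
      unfolding Int_Un_distrib2 using F(1) Cons.prems(2) True by (intro card_Un_disjoint) auto
    moreover have "card (F \<inter> Y) \<ge> 1" using F by (simp add: Suc_le_eq card_gt_0_iff)
    ultimately have "k * 1 + k * card (X \<inter> Y) \<le> k * card ((F \<union> X) \<inter> Y)"
      by (metis add_mult_distrib2 add_le_mono1 mult_le_mono2)
    then have "card (F \<union> X) \<le> k * card ((F \<union> X) \<inter> Y)"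
      using card_Un_le[of F X] F(2) Cons.prems(3) by linarith
    then show ?thesis using Cons F(1) True by simp
  next
    case False
    then show ?thesis using Cons by simp
  qed
qed simp

lemma card_greedy_packing_le:
  assumes "finite Y" "\<And>F. F \<in> set Fs \<Longrightarrow> finite F \<and> card F \<le> k \<and> F \<inter> Y \<noteq> {}"
  shows "card (greedy_packing Fs {}) \<le> k * card Y"
proof -
  have "card (greedy_packing Fs {}) \<le> k * card (greedy_packing Fs {} \<inter> Y)"
    using assms(2) by (intro card_greedy_packing_le_inter) auto
  also have "\<dots> \<le> k * card Y" using assms(1) by (intro mult_le_mono2 card_mono) auto
  finally show ?thesis .
qed

subsection \<open>Sets as bit masks\<close>

abbreviation bitset :: "nat \<Rightarrow> nat set" where "bitset s \<equiv> {i. bit s i}"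

lemma bit_add_disjoint_power:
  fixes s :: nat
  assumes "\<not> bit s u"
  shows "bit (s + 2 ^ u) i \<longleftrightarrow> bit s i \<or> i = u"
proof -
  have "s + 2 ^ u = or s (2 ^ u)"
    by (rule disjunctive_add) (use assms in \<open>auto simp: bit_exp_iff\<close>)
  then show ?thesis by (auto simp: bit_or_iff bit_exp_iff)
qed

definition mask_step :: "(nat \<Rightarrow> nat \<Rightarrow> nat \<Rightarrow> bool) \<Rightarrow> nat \<times> nat \<times> nat \<Rightarrow> nat \<Rightarrow> nat" where
  "mask_step P = (\<lambda>(u, v, w) s.
     if P u v w \<and> \<not> bit s u \<and> \<not> bit s v \<and> \<not> bit s w then s + 2 ^ u + 2 ^ v + 2 ^ w else s)"

definition triples :: "nat \<Rightarrow> (nat \<times> nat \<times> nat) list" where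
  "triples n = [(u, v, w). u \<leftarrow> [0..<n], v \<leftarrow> [0..<n], w \<leftarrow> [0..<n]]"

definition triple_mask :: "(nat \<Rightarrow> nat \<Rightarrow> nat \<Rightarrow> bool) \<Rightarrow> nat \<Rightarrow> nat" where
  "triple_mask P n = fold (mask_step P) (triples n) 0"

lemma set_triples: "set (triples n) = {..<n} \<times> {..<n} \<times> {..<n}"
  by (auto simp: triples_def image_iff)

lemma fold_concat_map: "fold f (concat (map g xs)) = fold (\<lambda>x. fold f (g x)) xs"
  by (induction xs) (simp_all add: fun_eq_iff)

lemma triple_mask_nested_fold:
  "triple_mask P n =
     fold (\<lambda>u. fold (\<lambda>v. fold (\<lambda>w. mask_step P (u, v, w)) [0..<n]) [0..<n]) [0..<n] 0"
  by (simp add: triple_mask_def triples_def fold_concat_map fold_map comp_def)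

lemma bitset_fold_mask_step:
  assumes distinct: "\<And>u v w. P u v w \<Longrightarrow> u \<noteq> v \<and> v \<noteq> w \<and> u \<noteq> w"
  shows "bitset (fold (mask_step P) ts s) =
    greedy_packing (map (\<lambda>(u, v, w). {u, v, w}) (filter (\<lambda>(u, v, w). P u v w) ts)) (bitset s)"
proof (induction ts arbitrary: s)
  case (Cons t ts)
  obtain u v w where t: "t = (u, v, w)" by (cases t)
  have "bitset (mask_step P (u, v, w) s) =
      (if P u v w \<and> {u, v, w} \<inter> bitset s = {} then {u, v, w} \<union> bitset s else bitset s)"
    using distinct[of u v w] by (auto simp: mask_step_def bit_add_disjoint_power)
  then show ?case by (simp add: t Cons)
qed simp

context
  fixes P :: "nat \<Rightarrow> nat \<Rightarrow> nat \<Rightarrow> bool"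
  assumes distinct: "\<And>u v w. P u v w \<Longrightarrow> u \<noteq> v \<and> v \<noteq> w \<and> u \<noteq> w"
begin

lemma bitset_triple_mask:
  "bitset (triple_mask P n) =
     greedy_packing (map (\<lambda>(u, v, w). {u, v, w}) (filter (\<lambda>(u, v, w). P u v w) (triples n))) {}"
  unfolding triple_mask_def using bitset_fold_mask_step[of P, OF distinct]
  by (simp add: bot_fun_def)

lemma triple_mask_hits:
  assumes "P u v w" "u < n" "v < n" "w < n"
  shows "{u, v, w} \<inter> bitset (triple_mask P n) \<noteq> {}"
  unfolding bitset_triple_mask using assms by (intro greedy_packing_hits) (auto simp: set_triples)

lemma bitset_triple_mask_subset: "bitset (triple_mask P n) \<subseteq> {..<n}"
  unfolding bitset_triple_mask
  by (rule order_trans[OF greedy_packing_subset]) (auto simp: set_triples)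

lemma card_triple_mask_le:
  assumes "finite Y" "\<And>u v w. P u v w \<Longrightarrow> {u, v, w} \<inter> Y \<noteq> {}"
  shows "card (bitset (triple_mask P n)) \<le> 3 * card Y"
  unfolding bitset_triple_mask
proof (rule card_greedy_packing_le[OF assms(1)])
  fix F assume "F \<in> set (map (\<lambda>(u, v, w). {u, v, w}) (filter (\<lambda>(u, v, w). P u v w) (triples n)))"
  then obtain u v w where "F = set [u, v, w]" "P u v w" by auto
  then show "finite F \<and> card F \<le> 3 \<and> F \<inter> Y \<noteq> {}"
    using assms(2)[of u v w] card_length[of "[u, v, w]"] by simp
qed

end

section \<open>Boolean expressions\<close>

definition holds :: "nat list \<Rightarrow> expr \<Rightarrow> nat list \<Rightarrow> bool" where
  "holds xs e env \<longleftrightarrow> eval xs e env \<noteq> 0"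

definition And :: "expr \<Rightarrow> expr \<Rightarrow> expr" where
  "And a b = Cond a b (Num 0)"

definition Or :: "expr \<Rightarrow> expr \<Rightarrow> expr" where
  "Or a b = Cond a (Num 1) b"

definition Imp :: "expr \<Rightarrow> expr \<Rightarrow> expr" where
  "Imp a b = Cond a b (Num 1)"

definition Neg :: "expr \<Rightarrow> expr" where
  "Neg a = Cond a (Num 0) (Num 1)"

definition Iff :: "expr \<Rightarrow> expr \<Rightarrow> expr" where
  "Iff a b = Cond a b (Neg b)"

definition Less :: "expr \<Rightarrow> expr \<Rightarrow> expr" where
  "Less a b = Minus b a"

definition Equal :: "expr \<Rightarrow> expr \<Rightarrow> expr" where
  "Equal a b = Neg (Plus (Minus a b) (Minus b a))"

definition Exists :: "expr \<Rightarrow> expr \<Rightarrow> expr" where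
  "Exists e b = Loop e (Num 0) (Cond (Init b) (Num 1) (Last 1 (Var 0)))"

definition Forall :: "expr \<Rightarrow> expr \<Rightarrow> expr" where
  "Forall e b = Neg (Exists e (Neg b))"

definition Count :: "expr \<Rightarrow> expr \<Rightarrow> expr" where
  "Count e b = Loop e (Num 0) (Plus (Last 1 (Var 0)) (Cond (Init b) (Num 1) (Num 0)))"

text \<open>The arguments are evaluated in an environment extended by the earlier arguments, which is
  harmless because variables are numbered from the bottom of the environment.\<close>

definition Call :: "expr \<Rightarrow> expr list \<Rightarrow> expr" where
  [simp]: "Call f es = foldr Bind es (Last (length es) f)"

lemma eval_Cond [simp]:
  "eval xs (Cond a b c) env = (if holds xs a env then eval xs b env else eval xs c env)"
  by (simp add: holds_def)

lemma loops_bounded_Cond [simp]: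
  "loops_bounded W xs (Cond a b c) env \<longleftrightarrow>
     loops_bounded W xs a env \<and>
     (if holds xs a env then loops_bounded W xs b env else loops_bounded W xs c env)"
  by (simp add: holds_def)

declare eval.simps(7) [simp del] loops_bounded.simps(7) [simp del]

lemma holds_Num [simp]: "holds xs (Num c) env \<longleftrightarrow> c \<noteq> 0"
  by (simp add: holds_def)

lemma holds_Cond [simp]:
  "holds xs (Cond a b c) env \<longleftrightarrow> (if holds xs a env then holds xs b env else holds xs c env)"
  by (simp add: holds_def)

lemma holds_Bind [simp]: "holds xs (Bind a b) env \<longleftrightarrow> holds xs b (env @ [eval xs a env])"
  by (simp add: holds_def)

lemma holds_Last [simp]: "holds xs (Last k a) env \<longleftrightarrow> holds xs a (drop (length env - k) env)"
  by (simp add: holds_def)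

lemma holds_Init [simp]: "holds xs (Init a) env \<longleftrightarrow> holds xs a (butlast env)"
  by (simp add: holds_def)

lemma eval_Exists: "eval xs (Exists e b) env = of_bool (\<exists>i<eval xs e env. holds xs b (env @ [i]))"
proof -
  have "fold (\<lambda>i r. if P i then 1 else r) [0..<m] 0 = (of_bool (\<exists>i<m. P i) :: nat)" for P m
    by (induction m) (auto simp: less_Suc_eq simp del: One_nat_def)
  then show ?thesis by (simp add: Exists_def butlast_append del: One_nat_def cong: if_cong)
qed

lemma eval_Count: "eval xs (Count e b) env = card {i. i < eval xs e env \<and> holds xs b (env @ [i])}"
proof -
  have "fold (\<lambda>i r. r + (if P i then 1 else 0)) [0..<m] 0 = card {i. i < m \<and> P i}"
    for P and m :: nat
  proof (induction m)
    case (Suc m)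
    have "{i. i < Suc m \<and> P i} = (if P m then insert m {i. i < m \<and> P i} else {i. i < m \<and> P i})"
      by (auto simp: less_Suc_eq)
    then show ?case using Suc by (simp del: One_nat_def)
  qed simp
  then show ?thesis by (simp add: Count_def butlast_append del: One_nat_def cong: if_cong)
qed

lemma holds_connectives [simp]:
  "holds xs (And a b) env \<longleftrightarrow> holds xs a env \<and> holds xs b env"
  "holds xs (Or a b) env \<longleftrightarrow> holds xs a env \<or> holds xs b env"
  "holds xs (Imp a b) env \<longleftrightarrow> (holds xs a env \<longrightarrow> holds xs b env)"
  "holds xs (Neg a) env \<longleftrightarrow> \<not> holds xs a env"
  "holds xs (Iff a b) env \<longleftrightarrow> (holds xs a env \<longleftrightarrow> holds xs b env)"
  by (auto simp: And_def Or_def Imp_def Neg_def Iff_def)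

lemma holds_comparisons [simp]:
  "holds xs (Less a b) env \<longleftrightarrow> eval xs a env < eval xs b env"
  "holds xs (Equal a b) env \<longleftrightarrow> eval xs a env = eval xs b env"
  by (auto simp: Less_def Equal_def) (auto simp: holds_def)

lemma holds_Exists [simp]:
  "holds xs (Exists e b) env \<longleftrightarrow> (\<exists>i<eval xs e env. holds xs b (env @ [i]))"
  by (simp add: holds_def[of _ "Exists e b"] eval_Exists)

lemma holds_Forall [simp]:
  "holds xs (Forall e b) env \<longleftrightarrow> (\<forall>i<eval xs e env. holds xs b (env @ [i]))"
  by (simp add: Forall_def)

lemma loops_bounded_connectives [simp]:
  "loops_bounded W xs (And a b) env \<longleftrightarrow>
     loops_bounded W xs a env \<and> (holds xs a env \<longrightarrow> loops_bounded W xs b env)"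
  "loops_bounded W xs (Or a b) env \<longleftrightarrow>
     loops_bounded W xs a env \<and> (\<not> holds xs a env \<longrightarrow> loops_bounded W xs b env)"
  "loops_bounded W xs (Imp a b) env \<longleftrightarrow>
     loops_bounded W xs a env \<and> (holds xs a env \<longrightarrow> loops_bounded W xs b env)"
  "loops_bounded W xs (Neg a) env \<longleftrightarrow> loops_bounded W xs a env"
  "loops_bounded W xs (Iff a b) env \<longleftrightarrow> loops_bounded W xs a env \<and> loops_bounded W xs b env"
  "loops_bounded W xs (Less a b) env \<longleftrightarrow> loops_bounded W xs a env \<and> loops_bounded W xs b env"
  "loops_bounded W xs (Equal a b) env \<longleftrightarrow> loops_bounded W xs a env \<and> loops_bounded W xs b env"
  by (auto simp: And_def Or_def Imp_def Neg_def Iff_def Less_def Equal_def)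

lemma loops_bounded_quantifiers [simp]:
  "loops_bounded W xs (Exists e b) env \<longleftrightarrow> loops_bounded W xs e env \<and> eval xs e env \<le> W \<and>
     (\<forall>i<eval xs e env. loops_bounded W xs b (env @ [i]))"
  "loops_bounded W xs (Forall e b) env \<longleftrightarrow> loops_bounded W xs e env \<and> eval xs e env \<le> W \<and>
     (\<forall>i<eval xs e env. loops_bounded W xs b (env @ [i]))"
  "loops_bounded W xs (Count e b) env \<longleftrightarrow> loops_bounded W xs e env \<and> eval xs e env \<le> W \<and>
     (\<forall>i<eval xs e env. loops_bounded W xs b (env @ [i]))"
  by (auto simp: Exists_def Forall_def Count_def butlast_append)

section \<open>Arithmetic\<close>

definition mul_expr :: expr where
  "mul_expr = (let a = Var 0; b = Var 1; acc = Var 3 in Loop a (Num 0) (Plus acc b))"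

definition pow2_expr :: expr where
  "pow2_expr = (let a = Var 0; acc = Var 2 in Loop a (Num 1) (Plus acc acc))"

definition shift_left_expr :: expr where
  "shift_left_expr = (let x = Var 0; i = Var 1; acc = Var 3 in Loop i x (Plus acc acc))"

definition shift_right_expr :: expr where
  "shift_right_expr = (let x = Var 0; i = Var 1; acc = Var 3 in Loop i x (Hlf acc))"

definition bit_expr :: expr where
  "bit_expr = (let x = Var 0; i = Var 1; y = Var 2
     in Bind (Call shift_right_expr [x, i]) (Minus y (Plus (Hlf y) (Hlf y))))"

lemma eval_mul [simp]: "eval xs mul_expr [a, b] = a * b"
proof -
  have "fold (\<lambda>i r. r + b) [0..<a] 0 = a * b" by (induction a) auto
  then show ?thesis by (simp add: mul_expr_def Let_def)
qed

lemma loops_bounded_mul [simp]: "loops_bounded W xs mul_expr [a, b] \<longleftrightarrow> a \<le> W"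
  by (simp add: mul_expr_def Let_def)

lemma eval_pow2 [simp]: "eval xs pow2_expr [a] = 2 ^ a"
proof -
  have "fold (\<lambda>i r. r + r) [0..<a] (1 :: nat) = 2 ^ a" by (induction a) auto
  then show ?thesis by (simp add: pow2_expr_def Let_def)
qed

lemma loops_bounded_pow2 [simp]: "loops_bounded W xs pow2_expr [a] \<longleftrightarrow> a \<le> W"
  by (simp add: pow2_expr_def Let_def)

lemma eval_shift_left [simp]: "eval xs shift_left_expr [x, i] = x * 2 ^ i"
proof -
  have "fold (\<lambda>i r. r + r) [0..<i] x = x * 2 ^ i" by (induction i) auto
  then show ?thesis by (simp add: shift_left_expr_def Let_def)
qed

lemma loops_bounded_shift_left [simp]: "loops_bounded W xs shift_left_expr [x, i] \<longleftrightarrow> i \<le> W"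
  by (simp add: shift_left_expr_def Let_def)

lemma eval_shift_right [simp]: "eval xs shift_right_expr [x, i] = x div 2 ^ i"
proof -
  have "fold (\<lambda>i r. r div 2) [0..<i] x = x div 2 ^ i"
    by (induction i) (auto simp: div_mult2_eq[symmetric] mult.commute)
  then show ?thesis by (simp add: shift_right_expr_def Let_def)
qed

lemma loops_bounded_shift_right [simp]: "loops_bounded W xs shift_right_expr [x, i] \<longleftrightarrow> i \<le> W"
  by (simp add: shift_right_expr_def Let_def)

lemma holds_bit [simp]: "holds xs bit_expr [x, i] \<longleftrightarrow> bit x i"
proof -
  have "y \<le> y div 2 + y div 2 \<longleftrightarrow> even y" for y :: nat by presburger
  then show ?thesis by (simp add: bit_expr_def Let_def holds_def bit_iff_odd)
qed

lemma loops_bounded_bit [simp]: "loops_bounded W xs bit_expr [x, i] \<longleftrightarrow> i \<le> W"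
  by (simp add: bit_expr_def Let_def)

subsection \<open>Coding of integer endpoints\<close>

definition digit :: "nat \<Rightarrow> nat \<Rightarrow> nat \<Rightarrow> nat" where
  "digit z b p = z div 2 ^ (b * p) mod 2 ^ b"

definition digit_expr :: expr where
  "digit_expr = (let z = Var 0; b = Var 1; p = Var 2; y = Var 3
     in Bind (Call shift_right_expr [z, Call mul_expr [b, p]])
          (Minus y (Call shift_left_expr [Call shift_right_expr [y, b], b])))"

lemma eval_digit [simp]: "eval xs digit_expr [z, b, p] = digit z b p"
  by (simp add: digit_expr_def Let_def digit_def minus_div_mult_eq_mod)

lemma loops_bounded_digit [simp]:
  "loops_bounded W xs digit_expr [z, b, p] \<longleftrightarrow> b \<le> W \<and> b * p \<le> W"
  by (auto simp: digit_expr_def Let_def)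

lemma digits_exist:
  fixes g :: "nat \<Rightarrow> nat"
  assumes "\<And>p. p < L \<Longrightarrow> g p < 2 ^ b"
  shows "\<exists>z<2 ^ (b * L). \<forall>p<L. digit z b p = g p"
  using assms
proof (induction L arbitrary: g)
  case (Suc L)
  from Suc.IH[of "\<lambda>p. g (Suc p)"] Suc.prems
  obtain z where z: "z < 2 ^ (b * L)" "\<forall>p<L. digit z b p = g (Suc p)" by auto
  define y where "y = g 0 + 2 ^ b * z"
  have g0: "g 0 < 2 ^ b" using Suc.prems by simp
  then have "y < 2 ^ b * (z + 1)" by (simp add: y_def)
  also have "\<dots> \<le> 2 ^ b * 2 ^ (b * L)" using z(1) by (intro mult_le_mono2) simp
  finally have "y < 2 ^ (b * Suc L)" by (simp add: power_add)
  moreover have "digit y b 0 = g 0" using g0 by (simp add: digit_def y_def)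
  moreover have "digit y b (Suc p) = digit z b p" for p
    using g0 by (simp add: digit_def y_def power_add div_mult2_eq)
  ultimately show ?case using z(2) by (auto simp: All_less_Suc2)
qed simp

text \<open>A code \<open>z\<close> lists the boxes one after the other, each as \<open>m\<close> pairs of \<open>b\<close>-bit endpoints.\<close>

definition left_end :: "nat \<Rightarrow> nat \<Rightarrow> nat \<Rightarrow> nat \<Rightarrow> nat \<Rightarrow> nat" where
  "left_end z b m p i = digit z b (2 * (p * m + i))"

definition right_end :: "nat \<Rightarrow> nat \<Rightarrow> nat \<Rightarrow> nat \<Rightarrow> nat \<Rightarrow> nat" where
  "right_end z b m p i = digit z b (2 * (p * m + i) + 1)"

lemma end_index_less:
  fixes p m i h :: nat
  assumes "p < h" "i < m"
  shows "2 * (p * m + i) + 1 < 2 * (h * m)"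
proof -
  have "Suc p * m \<le> h * m" using assms(1) by (intro mult_le_mono1) simp
  then show ?thesis using assms(2) by simp
qed

lemma code_exists:
  fixes l r :: "nat \<Rightarrow> nat \<Rightarrow> nat"
  assumes "\<And>p i. p < h \<Longrightarrow> i < m \<Longrightarrow> l p i < 2 ^ b" "\<And>p i. p < h \<Longrightarrow> i < m \<Longrightarrow> r p i < 2 ^ b"
  shows "\<exists>z<2 ^ (b * (2 * (h * m))). \<forall>p<h. \<forall>i<m.
    left_end z b m p i = l p i \<and> right_end z b m p i = r p i"
proof -
  define g where "g k = (if even k then l else r) (k div 2 div m) (k div 2 mod m)" for k
  have "g k < 2 ^ b" if "k < 2 * (h * m)" for k
  proof -
    have "k div 2 < h * m" using that by simp
    then have "k div 2 div m < h" "k div 2 mod m < m"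
      by (auto simp: less_mult_imp_div_less intro!: mod_less_divisor Nat.gr0I)
    then show ?thesis using assms by (simp add: g_def)
  qed
  then obtain z where z: "z < 2 ^ (b * (2 * (h * m)))" "\<forall>k<2 * (h * m). digit z b k = g k"
    using digits_exist[of "2 * (h * m)" g b] by blast
  have "left_end z b m p i = l p i \<and> right_end z b m p i = r p i" if "p < h" "i < m" for p i
    using z(2) end_index_less[OF that] that by (simp add: left_end_def right_end_def g_def)
  with z(1) show ?thesis by blast
qed

lemma box_representable_iff_code:
  fixes A :: "'a::linorder set"
  assumes fin: "finite A" and b: "2 * card A \<le> 2 ^ b"
  shows "box_representable A E m \<longleftrightarrow> (\<exists>z<2 ^ (b * (2 * (card A * m))). \<forall>u\<in>A. \<forall>v\<in>A.
    E u v \<longleftrightarrow> boxes_meet m (left_end z b m) (right_end z b m) (rank_in A u) (rank_in A v))"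
    (is "_ \<longleftrightarrow> (\<exists>z<_. ?codes z)")
proof
  assume "\<exists>z<2 ^ (b * (2 * (card A * m))). ?codes z"
  then obtain z where "?codes z" by blast
  then show "box_representable A E m"
    by (intro box_representableI[where l = "\<lambda>u i. left_end z b m (rank_in A u) i"
          and r = "\<lambda>u i. right_end z b m (rank_in A u) i"])
      (simp add: boxes_meet_def)
next
  assume "box_representable A E m"
  then obtain l r :: "'a \<Rightarrow> nat \<Rightarrow> nat" where
    lr: "\<And>u i. u \<in> A \<Longrightarrow> l u i < 2 * card A" "\<And>u i. u \<in> A \<Longrightarrow> r u i < 2 * card A"
    and E: "\<And>u v. u \<in> A \<Longrightarrow> v \<in> A \<Longrightarrow> E u v \<longleftrightarrow> boxes_meet m l r u v"
    by (rule box_representable_nat_endpoints[OF fin]) (rule that; assumption)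
  define w where "w = inv_into A (rank_in A)"
  have w: "w p \<in> A" if "p < card A" for p
    using bij_betw_inv_into[OF bij_betw_rank_in[OF fin]] that by (auto simp: w_def bij_betw_def)
  obtain z where z: "z < 2 ^ (b * (2 * (card A * m)))"
    "\<forall>p<card A. \<forall>i<m. left_end z b m p i = l (w p) i \<and> right_end z b m p i = r (w p) i"
    using code_exists[of "card A" m "\<lambda>p. l (w p)" b "\<lambda>p. r (w p)"] lr[OF w] b less_le_trans by blast
  have "w (rank_in A u) = u" if "u \<in> A" for u
    unfolding w_def using bij_betw_rank_in[OF fin] that by (simp add: bij_betw_def)
  then have "?codes z"
    using z(2) rank_in_less_card[OF fin] by (simp add: E boxes_meet_def)
  then show "\<exists>z<2 ^ (b * (2 * (card A * m))). ?codes z" using z(1) by blast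
qed

section \<open>The algorithm\<close>

definition n_expr :: expr where
  "n_expr = Inp (Num 0)"

definition sign_expr :: expr where
  "sign_expr = Inp (Num 1)"

definition dim_expr :: expr where
  "dim_expr = (let k = Var 0; d = Inp (Num 2)
     in Cond (Less d (Plus k (Num 1))) d (Plus k (Num 1)))"

definition adj_expr :: expr where
  "adj_expr = (let u = Var 0; v = Var 1
     in Or (Equal u v) (And (And (Less u n_expr) (Less v n_expr))
          (Inp (Plus (Num 3) (Plus (Call mul_expr [u, n_expr]) v)))))"

text \<open>The gaps in the environment are the accumulators of the outer loops.\<close>

definition modulator_step_expr :: expr where
  "modulator_step_expr = (let u = Var 0; v = Var 2; w = Var 4; s = Var 5
     in Cond
          (And (And (Call adj_expr [u, v])
              (And (Call adj_expr [v, w]) (Neg (Call adj_expr [u, w]))))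
            (And (Neg (Call bit_expr [s, u])) (And (Neg (Call bit_expr [s, v]))
              (Neg (Call bit_expr [s, w])))))
          (Plus (Plus (Plus s (Call pow2_expr [u])) (Call pow2_expr [v])) (Call pow2_expr [w]))
          s)"

definition modulator_expr :: expr where
  "modulator_expr = Loop n_expr (Num 0)
     (Loop n_expr (Last 1 (Var 0)) (Loop n_expr (Last 1 (Var 0)) modulator_step_expr))"

definition member_expr :: expr where
  "member_expr = (let s = Var 0; v = Var 1 in And (Less v n_expr) (Call bit_expr [s, v]))"

definition outside_expr :: expr where
  "outside_expr = (let s = Var 0; v = Var 1 in And (Less v n_expr) (Neg (Call bit_expr [s, v])))"

definition same_nbh_expr :: expr where
  "same_nbh_expr = (let s = Var 0; u = Var 1; v = Var 2; w = Var 3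
     in Forall n_expr (Imp (Call member_expr [s, w])
          (Iff (Call adj_expr [u, w]) (Call adj_expr [v, w]))))"

definition types_subset_expr :: expr where
  "types_subset_expr = (let s = Var 0; u = Var 1; v = Var 2; x = Var 3; y = Var 4
     in Forall n_expr (Imp (And (Call outside_expr [s, x]) (Call adj_expr [x, u]))
          (Exists n_expr (And (And (Call outside_expr [s, y]) (Call adj_expr [y, v]))
            (Call same_nbh_expr [s, x, y])))))"

definition leader_expr :: expr where
  "leader_expr = (let s = Var 0; c = Var 1; u = Var 2
     in And (Call outside_expr [s, c])
          (Neg (Exists c (And (Call outside_expr [s, u]) (Call adj_expr [u, c])))))"

definition first_twin_expr :: expr where
  "first_twin_expr = (let s = Var 0; v = Var 1; u = Var 2
     in And (Call outside_expr [s, v])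
          (Neg (Exists v (And (And (Call outside_expr [s, u]) (Call adj_expr [u, v]))
            (Call same_nbh_expr [s, u, v])))))"

definition earlier_expr :: expr where
  "earlier_expr = (let s = Var 0; c = Var 1; c' = Var 2
     in Count c (And (Call leader_expr [s, c'])
          (And (Call types_subset_expr [s, c, c']) (Call types_subset_expr [s, c', c]))))"

definition kept_expr :: expr where
  "kept_expr = (let s = Var 0; N = Var 1; v = Var 2; c = Var 3
     in Or (Call member_expr [s, v])
          (And (Call first_twin_expr [s, v])
            (Exists n_expr (And (And (Call leader_expr [s, c]) (Call adj_expr [v, c]))
              (Neg (Less N (Call earlier_expr [s, c])))))))"

definition rank_expr :: expr where
  "rank_expr = (let s = Var 0; N = Var 1; v = Var 2; u = Var 3
     in Count v (Call kept_expr [s, N, u]))"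

definition left_end_expr :: expr where
  "left_end_expr = (let z = Var 0; b = Var 1; m = Var 2; p = Var 3; i = Var 4; j = Var 5
     in Bind (Plus (Call mul_expr [p, m]) i) (Call digit_expr [z, b, Plus j j]))"

definition right_end_expr :: expr where
  "right_end_expr = (let z = Var 0; b = Var 1; m = Var 2; p = Var 3; i = Var 4; j = Var 5
     in Bind (Plus (Call mul_expr [p, m]) i) (Call digit_expr [z, b, Plus j (Plus j (Num 1))]))"

definition meet_expr :: expr where
  "meet_expr = (let z = Var 0; b = Var 1; m = Var 2; p = Var 3; q = Var 4; i = Var 5
     in Forall m
          (And (Neg (Less (Call right_end_expr [z, b, m, q, i])
              (Call left_end_expr [z, b, m, p, i])))
            (Neg (Less (Call right_end_expr [z, b, m, p, i])
              (Call left_end_expr [z, b, m, q, i])))))"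

definition check_expr :: expr where
  "check_expr = (let s = Var 0; N = Var 1; m = Var 2; b = Var 3; z = Var 4; u = Var 5; v = Var 6
     in Forall n_expr (Imp (Call kept_expr [s, N, u])
          (Forall n_expr (Imp (Call kept_expr [s, N, v])
            (Iff (Call adj_expr [u, v])
              (Call meet_expr [z, b, m, Call rank_expr [s, N, u], Call rank_expr [s, N, v]]))))))"

definition search_expr :: expr where
  "search_expr = (let s = Var 0; N = Var 1; m = Var 2; h = Var 3; b = Var 4; z = Var 5;
       hm = Call mul_expr [h, m]
     in Exists (Call pow2_expr [Call mul_expr [b, Plus hm hm]]) (Call check_expr [s, N, m, b, z]))"

definition copies_bound_expr :: expr where
  "copies_bound_expr = (let k = Var 0; m = Var 1; t = Call pow2_expr [k]
     in Call pow2_expr [Call mul_expr [Plus (Plus t t) (Plus (Plus k k) (Plus k k)), m]])"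

definition main_expr :: expr where
  "main_expr = (let s = Var 0; k = Var 1; m = Var 2; N = Var 3; h = Var 4
     in Cond sign_expr (Num 0)
          (Bind modulator_expr
          (Bind (Count n_expr (Call member_expr [s, Var 1]))
          (Bind (Call dim_expr [k])
          (Bind (Call copies_bound_expr [k, m])
          (Bind (Call rank_expr [s, N, n_expr])
          (Call search_expr [s, N, m, h, Plus h h])))))))"

lemma eval_left_end [simp]: "eval xs left_end_expr [z, b, m, p, i] = left_end z b m p i"
  by (simp add: left_end_expr_def Let_def left_end_def flip: mult_2)

lemma eval_right_end [simp]: "eval xs right_end_expr [z, b, m, p, i] = right_end z b m p i"
  by (simp add: right_end_expr_def Let_def right_end_def flip: mult_2)

lemma holds_meet [simp]:
  "holds xs meet_expr [z, b, m, p, q] \<longleftrightarrow> boxes_meet m (left_end z b m) (right_end z b m) p q"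
  by (simp add: meet_expr_def Let_def boxes_meet_def not_less)

lemma
  assumes "p < h" "i < m" "h \<le> W" "b \<le> W" "b * (2 * (h * m)) \<le> W"
  shows loops_bounded_left_end: "loops_bounded W xs left_end_expr [z, b, m, p, i]"
    and loops_bounded_right_end: "loops_bounded W xs right_end_expr [z, b, m, p, i]"
proof -
  have "b * (2 * (p * m + i) + 1) \<le> b * (2 * (h * m))"
    using end_index_less[OF assms(1,2)] by (intro mult_le_mono2 less_imp_le)
  then have "b * (2 * (p * m + i) + 1) \<le> W" using assms(5) by linarith
  then show "loops_bounded W xs left_end_expr [z, b, m, p, i]"
    and "loops_bounded W xs right_end_expr [z, b, m, p, i]"
    using assms by (simp_all add: left_end_expr_def right_end_expr_def Let_def flip: mult_2)
qed

lemma loops_bounded_meet: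
  assumes "p < h" "q < h" "h \<le> W" "b \<le> W" "b * (2 * (h * m)) \<le> W" "m \<le> W"
  shows "loops_bounded W xs meet_expr [z, b, m, p, q]"
  using assms loops_bounded_left_end[of _ h _ m W b] loops_bounded_right_end[of _ h _ m W b]
  by (simp add: meet_expr_def Let_def)

lemma eval_copies_bound [simp]: "eval xs copies_bound_expr [k, m] = copies_bound k m"
proof -
  have "2 ^ k + 2 ^ k + (k + k + (k + k)) = 2 * 2 ^ k + 4 * k" by simp
  then show ?thesis by (simp only: copies_bound_def) (simp add: copies_bound_expr_def Let_def)
qed

lemma eval_search:
  "eval xs search_expr [s, N, m, h, b] =
     of_bool (\<exists>z<2 ^ (b * (2 * (h * m))). holds xs check_expr [s, N, m, b, z])"
  by (simp add: search_expr_def Let_def eval_Exists mult_2)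

lemma length_concat_matrix: "length (concat (map (\<lambda>u. map (f u) [0..<n]) [0..<m])) = m * n"
  by (induction m) auto

lemma nth_concat_matrix:
  assumes "u < m" "v < n"
  shows "concat (map (\<lambda>u. map (f u) [0..<n]) [0..<m]) ! (u * n + v) = f u v"
  using assms(1)
proof (induction m)
  case (Suc m)
  show ?case
  proof (cases "u = m")
    case False
    then have "Suc u * n \<le> m * n" using Suc.prems by (intro mult_le_mono1) simp
    then have "u * n + v < m * n" using assms(2) by simp
    then show ?thesis using Suc False by (simp add: nth_append length_concat_matrix)
  qed (use assms(2) in \<open>simp add: nth_append length_concat_matrix\<close>)
qed simp

locale boxicity_input =
  fixes G :: "nat pair_pre_digraph" and n :: nat and d :: int
  assumes graph: "pair_graph G" and verts: "pverts G = {0..<n}"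
begin

sublocale pair_graph G by (rule graph)

abbreviation xs :: "nat list" where
  "xs \<equiv> boxicity_instance G d"

definition E :: "nat \<Rightarrow> nat \<Rightarrow> bool" where
  "E u v \<longleftrightarrow> u = v \<or> (u, v) \<in> parcs G"

lemma E_eq_adj_or_eq: "E = adj_or_eq (with_proj G)"
  by (intro ext) (auto simp: E_def arcs_ends_def arc_to_ends_def)

lemma E_symmetric: "E u v \<longleftrightarrow> E v u"
  unfolding E_def using arcs_symmetric by blast

lemma E_less: "E u v \<Longrightarrow> u \<noteq> v \<Longrightarrow> u < n \<and> v < n"
  using in_arcsD1 in_arcsD2 verts by (fastforce simp: E_def)

lemma instance_nth:
  "xs ! 0 = n" "xs ! 1 = of_bool (d < 0)" "xs ! 2 = nat \<bar>d\<bar>" "length xs = 3 + n * n"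
  by (simp_all add: boxicity_instance_def Let_def verts length_concat_matrix nth_Cons')

lemma instance_adj_nth:
  "u < n \<Longrightarrow> v < n \<Longrightarrow> xs ! (3 + (u * n + v)) = of_bool ((u, v) \<in> parcs G)"
  unfolding boxicity_instance_def Let_def by (simp add: verts nth_concat_matrix)

lemma eval_n [simp]: "eval xs n_expr env = n"
  by (simp add: n_expr_def instance_nth Let_def)

lemma loops_bounded_n [simp]: "loops_bounded W xs n_expr env"
  by (simp add: n_expr_def)

lemma holds_sign [simp]: "holds xs sign_expr env \<longleftrightarrow> d < 0"
  using instance_nth(2,4) by (simp add: sign_expr_def holds_def Let_def)

lemma loops_bounded_sign [simp]: "loops_bounded W xs sign_expr env"
  by (simp add: sign_expr_def)

lemma eval_dim [simp]: "eval xs dim_expr [k] = min (nat \<bar>d\<bar>) (k + 1)"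
proof -
  have "eval xs (Inp (Num 2)) env = nat \<bar>d\<bar>" for env
    using instance_nth(3,4) by (simp add: Let_def)
  then show ?thesis by (simp add: dim_expr_def Let_def min_def del: eval.simps(3))
qed

lemma loops_bounded_dim [simp]: "loops_bounded W xs dim_expr [k]"
  by (simp add: dim_expr_def Let_def)

lemma holds_adj [simp]: "holds xs adj_expr [u, v] \<longleftrightarrow> E u v"
proof (cases "u < n \<and> v < n")
  case True
  then have "Suc u * n \<le> n * n" by (intro mult_le_mono1) simp
  then have idx: "u * n + v < n * n" using True by simp
  have "holds xs (Inp (Plus (Num 3) (Plus (Call mul_expr [Var 0, n_expr]) (Var 1)))) [u, v] \<longleftrightarrow>
      (u, v) \<in> parcs G"
    using True instance_adj_nth[of u v] idx by (simp add: holds_def instance_nth)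
  then show ?thesis using True by (simp add: adj_expr_def Let_def E_def del: Call_def)
next
  case False
  then show ?thesis using E_less[of u v] by (auto simp: adj_expr_def Let_def E_def)
qed

lemma loops_bounded_adj [simp]: "n \<le> W \<Longrightarrow> loops_bounded W xs adj_expr [u, v]"
  by (simp add: adj_expr_def Let_def)

subsection \<open>The modulator\<close>

definition induced_path :: "nat \<Rightarrow> nat \<Rightarrow> nat \<Rightarrow> bool" where
  "induced_path u v w \<longleftrightarrow> E u v \<and> E v w \<and> \<not> E u w"

definition modulator_mask :: nat where
  "modulator_mask = triple_mask induced_path n"

lemma induced_path_distinct: "induced_path u v w \<Longrightarrow> u \<noteq> v \<and> v \<noteq> w \<and> u \<noteq> w"
  by (auto simp: induced_path_def E_def)

sublocale modulator: cluster_modulator "{..<n}" "bitset modulator_mask" E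
proof
  show "finite {..<n}" by simp
  show "bitset modulator_mask \<subseteq> {..<n}"
    unfolding modulator_mask_def by (rule bitset_triple_mask_subset) (rule induced_path_distinct)
  show "E u v \<longleftrightarrow> E v u" for u v by (rule E_symmetric)
  show "E v v" for v by (simp add: E_def)
  show "E u w"
    if "u \<in> {..<n} - bitset modulator_mask" "v \<in> {..<n} - bitset modulator_mask"
      "w \<in> {..<n} - bitset modulator_mask"
      "E u v" "E v w" for u v w
    using triple_mask_hits[of induced_path u v w n] induced_path_distinct that
    by (auto simp: induced_path_def modulator_mask_def)
qed

lemma card_modulator_le:
  "card (bitset modulator_mask) \<le> 3 * cluster_vertex_deletion_number (with_proj G)"
proof -
  obtain X where X: "X \<subseteq> pverts G"
    "card X = cluster_vertex_deletion_number (with_proj G)"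
    and hit: "\<And>u v w. \<lbrakk>(u, v) \<in> parcs G; (v, w) \<in> parcs G; u \<noteq> w; (u, w) \<notin> parcs G\<rbrakk>
      \<Longrightarrow> u \<in> X \<or> v \<in> X \<or> w \<in> X"
    by (rule cluster_vertex_deletion_set) (rule that; assumption)
  have "finite X" using X(1) verts finite_subset by auto
  moreover have "{u, v, w} \<inter> X \<noteq> {}" if "induced_path u v w" for u v w
    using hit[of u v w] that induced_path_distinct[OF that]
    by (auto simp: induced_path_def E_def)
  ultimately show ?thesis
    unfolding modulator_mask_def X(2)[symmetric]
    by (intro card_triple_mask_le) (simp_all add: induced_path_distinct)
qed

lemma modulator_mask_less: "bit modulator_mask v \<Longrightarrow> v < n"
  using modulator.S_subset by auto

lemma eval_modulator [simp]: "eval xs modulator_expr [] = modulator_mask"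
  unfolding modulator_mask_def triple_mask_nested_fold mask_step_def induced_path_def
  by (simp add: modulator_expr_def modulator_step_expr_def Let_def cong: if_cong)

lemma loops_bounded_modulator [simp]: "n \<le> W \<Longrightarrow> loops_bounded W xs modulator_expr []"
  by (simp add: modulator_expr_def modulator_step_expr_def Let_def)

lemma holds_member [simp]: "holds xs member_expr [modulator_mask, v] \<longleftrightarrow> bit modulator_mask v"
  using modulator_mask_less by (auto simp: member_expr_def Let_def)

lemma loops_bounded_member [simp]: "n \<le> W \<Longrightarrow> loops_bounded W xs member_expr [s, v]"
  by (simp add: member_expr_def Let_def)

lemma holds_outside [simp]:
  "holds xs outside_expr [modulator_mask, v] \<longleftrightarrow> v \<in> {..<n} - bitset modulator_mask"
  by (simp add: outside_expr_def Let_def)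

lemma holds_same_nbh [simp]:
  "holds xs same_nbh_expr [modulator_mask, u, v] \<longleftrightarrow> modulator.nbh u = modulator.nbh v"
  using modulator_mask_less by (auto simp: same_nbh_expr_def Let_def modulator.nbh_def)

lemma holds_types_subset [simp]:
  "holds xs types_subset_expr [modulator_mask, u, v] \<longleftrightarrow> modulator.types u \<subseteq> modulator.types v"
proof -
  have "holds xs types_subset_expr [modulator_mask, u, v] \<longleftrightarrow>
      (\<forall>x\<in>modulator.cluster u. \<exists>y\<in>modulator.cluster v. modulator.nbh x = modulator.nbh y)"
    by (simp add: types_subset_expr_def Let_def modulator.cluster_def Ball_def Bex_def) blast
  then show ?thesis unfolding modulator.types_def by blast
qed

lemma holds_leader [simp]: "holds xs leader_expr [modulator_mask, c] \<longleftrightarrow> modulator.leader c"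
  by (auto simp: leader_expr_def Let_def modulator.leader_def modulator.cluster_def not_less)

lemma holds_first_twin [simp]:
  "holds xs first_twin_expr [modulator_mask, v] \<longleftrightarrow> modulator.first_twin v"
  by (auto simp: first_twin_expr_def Let_def modulator.first_twin_def modulator.cluster_def
      not_less)

lemma eval_earlier [simp]: "eval xs earlier_expr [modulator_mask, c] = card (modulator.earlier c)"
  by (auto simp: earlier_expr_def Let_def eval_Count modulator.earlier_def
      intro!: arg_cong[of _ _ card])

lemma holds_kept [simp]: "holds xs kept_expr [modulator_mask, N, v] \<longleftrightarrow> v \<in> modulator.kept N"
proof -
  have "modulator.leader c \<Longrightarrow> c < n" for c using modulator.leader_in by blast
  moreover have "modulator.first_twin v \<Longrightarrow> v \<in> {..<n} - bitset modulator_mask"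
    by (simp add: modulator.first_twin_def)
  ultimately show ?thesis
    by (auto simp: kept_expr_def Let_def modulator.kept_def modulator.restriction_def
        modulator.reduced_def modulator.cluster_def not_less)
qed

lemma loops_bounded_kept [simp]: "n \<le> W \<Longrightarrow> loops_bounded W xs kept_expr [modulator_mask, N, v]"
  by (auto simp: kept_expr_def earlier_expr_def first_twin_expr_def leader_expr_def
      types_subset_expr_def same_nbh_expr_def outside_expr_def Let_def)

lemma kept_less: "v \<in> modulator.kept N \<Longrightarrow> v < n"
  using modulator.restriction_subset by (auto simp: modulator.kept_def)

lemma finite_kept: "finite (modulator.kept N)"
  by (rule finite_subset[of _ "{..<n}"]) (auto dest: kept_less)

lemma card_kept_le_n: "card (modulator.kept N) \<le> n"
  using card_mono[of "{..<n}" "modulator.kept N"] kept_less by auto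

lemma eval_rank [simp]: "eval xs rank_expr [modulator_mask, N, v] = rank_in (modulator.kept N) v"
  by (auto simp: rank_expr_def Let_def eval_Count rank_in_def intro!: arg_cong[of _ _ card])

lemma eval_rank_n: "eval xs rank_expr [modulator_mask, N, n] = card (modulator.kept N)"
  using kept_less by (auto simp: rank_in_def intro!: arg_cong[of _ _ card])

lemma loops_bounded_rank [simp]:
  "n \<le> W \<Longrightarrow> v \<le> n \<Longrightarrow> loops_bounded W xs rank_expr [modulator_mask, N, v]"
  by (simp add: rank_expr_def Let_def)

lemma holds_check [simp]:
  "holds xs check_expr [modulator_mask, N, m, b, z] \<longleftrightarrow>
     (\<forall>u\<in>modulator.kept N. \<forall>v\<in>modulator.kept N. E u v \<longleftrightarrow>
        boxes_meet m (left_end z b m) (right_end z b m)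
          (rank_in (modulator.kept N) u) (rank_in (modulator.kept N) v))"
  using kept_less by (auto simp: check_expr_def Let_def)

lemma eval_search_kept:
  assumes "h = card (modulator.kept N)"
  shows "eval xs search_expr [modulator_mask, N, m, h, h + h] =
    of_bool (box_representable (modulator.kept N) E m)"
proof -
  have "2 * h \<le> 2 ^ (h + h)" using less_exp[of "h + h"] by (simp add: mult_2)
  then show ?thesis
    unfolding eval_search using box_representable_iff_code[OF finite_kept] assms by simp
qed

lemma loops_bounded_search:
  assumes "n \<le> W" "h = card (modulator.kept N)" "b \<le> W" "2 ^ (b * (2 * (h * m))) \<le> W" "m \<le> W"
  shows "loops_bounded W xs search_expr [modulator_mask, N, m, h, b]"
proof -
  have "h \<le> W" using card_kept_le_n[of N] assms(1,2) by simp
  moreover have "b * (2 * (h * m)) \<le> W" using less_exp[of "b * (2 * (h * m))"] assms(4) by linarith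
  ultimately show ?thesis
    using assms loops_bounded_meet[of _ h _ W b m] rank_in_less_card[OF finite_kept] kept_less
    by (simp add: search_expr_def check_expr_def Let_def mult_2 less_imp_le)
qed

end

section \<open>Correctness and running time\<close>

definition kernel_bound :: "nat \<Rightarrow> nat" where
  "kernel_bound k = k + 2 ^ 2 ^ k * (copies_bound k (k + 1) + 1) * 2 ^ k"

definition loop_exponent :: "nat \<Rightarrow> nat" where
  "loop_exponent k = 2 * kernel_bound k * (2 * (kernel_bound k * kernel_bound k))"

lemma copies_bound_mono: "k \<le> k' \<Longrightarrow> d \<le> d' \<Longrightarrow> copies_bound k d \<le> copies_bound k' d'"
  unfolding copies_bound_def by (intro power_increasing mult_le_mono add_le_mono) auto

lemma kernel_bound_mono: "k \<le> k' \<Longrightarrow> kernel_bound k \<le> kernel_bound k'"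
  unfolding kernel_bound_def
  by (intro add_le_mono mult_le_mono power_increasing copies_bound_mono) auto

lemma loop_exponent_mono: "k \<le> k' \<Longrightarrow> loop_exponent k \<le> loop_exponent k'"
  unfolding loop_exponent_def by (intro mult_le_mono kernel_bound_mono) auto

lemma Suc_le_kernel_bound: "k + 1 \<le> kernel_bound k"
  by (simp add: kernel_bound_def Suc_le_eq)

lemma copies_bound_le_kernel_bound: "copies_bound k (k + 1) \<le> kernel_bound k"
proof -
  have "1 * copies_bound k (k + 1) * 1 \<le> 2 ^ 2 ^ k * (copies_bound k (k + 1) + 1) * 2 ^ k"
    by (intro mult_le_mono) auto
  then show ?thesis by (simp add: kernel_bound_def)
qed

lemma kernel_bound_le_loop_exponent: "2 * kernel_bound k \<le> loop_exponent k"
  using Suc_le_kernel_bound[of k] by (simp add: loop_exponent_def)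

lemma loops_bounded_copies_bound:
  assumes "m \<le> k + 1" "copies_bound k (k + 1) \<le> W"
  shows "loops_bounded W xs copies_bound_expr [k, m]"
proof -
  define t :: nat where "t = 2 * 2 ^ k + 4 * k"
  have "t * (k + 1) < 2 ^ (t * (k + 1))" by (rule less_exp)
  also have "\<dots> \<le> W" using assms(2) by (simp only: copies_bound_def t_def)
  finally have "t * (k + 1) < W" .
  moreover have "t * m \<le> t * (k + 1)" using assms(1) by (rule mult_le_mono2)
  ultimately have "k \<le> W" "t \<le> W" "t * m \<le> W" by (auto simp: t_def)
  moreover have "2 ^ k + 2 ^ k + (k + k + (k + k)) = t" by (simp add: t_def)
  ultimately show ?thesis by (simp add: copies_bound_expr_def Let_def)
qed

definition loop_exponent_expr :: expr where
  "loop_exponent_expr = (let k = Var 0; c = Var 1; h = Var 2; hh = Call mul_expr [h, h]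
     in Bind (Call copies_bound_expr [k, Plus k (Num 1)])
        (Bind (Plus k (Call mul_expr
           [Call mul_expr [Call pow2_expr [Call pow2_expr [k]], Plus c (Num 1)],
             Call pow2_expr [k]]))
        (Call mul_expr [Plus h h, Plus hh hh])))"

definition time_expr :: "nat \<Rightarrow> nat \<Rightarrow> expr" where
  "time_expr K D = (let k = Inp (Num 0)
     in Call mul_expr [Num K, Call pow2_expr [Call mul_expr
          [Call loop_exponent_expr [Plus k (Plus k k)], Num D]]])"

lemma eval_loop_exponent [simp]: "eval xs loop_exponent_expr [k] = loop_exponent k"
  by (simp add: loop_exponent_expr_def Let_def loop_exponent_def kernel_bound_def mult_2)

lemma eval_time: "eval [k] (time_expr K D) [] = K * (2 ^ loop_exponent (3 * k)) ^ D"
proof -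
  have "3 * k = k + (k + k)" by simp
  then show ?thesis by (simp only: power_mult[symmetric]) (simp add: time_expr_def Let_def)
qed

context boxicity_input
begin

definition modulator_size :: nat where
  "modulator_size = card (bitset modulator_mask)"

definition dimension :: nat where
  "dimension = min (nat \<bar>d\<bar>) (modulator_size + 1)"

definition threshold :: nat where
  "threshold = copies_bound modulator_size dimension"

definition kept_vertices :: "nat set" where
  "kept_vertices = modulator.kept threshold"

lemma eval_Count_member:
  "eval xs (Count n_expr (Call member_expr [Var 0, Var 1])) [modulator_mask] = modulator_size"
  unfolding modulator_size_def
  by (auto simp: eval_Count dest: modulator_mask_less intro!: arg_cong[of _ _ card])

lemma eval_dim_modulator_size: "eval xs dim_expr [modulator_size] = dimension"
  by (simp add: dimension_def)

lemma eval_threshold: "eval xs copies_bound_expr [modulator_size, dimension] = threshold"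
  by (simp add: threshold_def)

lemma eval_rank_threshold: "eval xs rank_expr [modulator_mask, threshold, n] = card kept_vertices"
  unfolding kept_vertices_def by (rule eval_rank_n)

lemmas eval_main_parts = eval_Count_member[simplified] eval_dim_modulator_size eval_threshold
  eval_rank_threshold

lemma eval_main:
  "eval xs main_expr [] = of_bool (0 \<le> d \<and> box_representable kept_vertices E dimension)"
  using eval_search_kept[of "card kept_vertices" threshold dimension]
  by (simp add: main_expr_def Let_def eval_main_parts kept_vertices_def[symmetric]
      del: eval_dim eval_copies_bound eval_rank)

lemma boxicity_le_iff_kept_vertices:
  assumes "0 \<le> d"
  shows "int (boxicity (with_proj G)) \<le> d \<longleftrightarrow> box_representable kept_vertices E dimension"
proof -
  have full: "box_representable {..<n} E (modulator_size + 1)"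
    unfolding modulator_size_def by (rule modulator.box_representable_Suc_card_modulator)
  have "int (boxicity (with_proj G)) \<le> d \<longleftrightarrow> boxicity (with_proj G) \<le> nat d"
    using assms by linarith
  also have "\<dots> \<longleftrightarrow> box_representable {..<n} E (nat d)"
    using boxicity_le_iff[of "with_proj G", folded E_eq_adj_or_eq] full
    by (simp add: verts lessThan_atLeast0)
  also have "\<dots> \<longleftrightarrow> box_representable {..<n} E dimension"
    using assms full box_representable_mono[OF full, of "nat d"]
    by (auto simp: dimension_def min_def)
  also have "\<dots> \<longleftrightarrow> box_representable kept_vertices E dimension"
    unfolding kept_vertices_def
    by (rule modulator.box_representable_kept_iff[symmetric])
      (simp add: threshold_def modulator_size_def)
  finally show ?thesis .
qed

theorem eval_main_eq_boxicity:
  "eval xs main_expr [] = (if int (boxicity (with_proj G)) \<le> d then 1 else 0)"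
  using boxicity_le_iff_kept_vertices by (auto simp: eval_main)

lemma card_kept_vertices_le: "card kept_vertices \<le> kernel_bound modulator_size"
proof -
  have "threshold \<le> copies_bound modulator_size (modulator_size + 1)"
    unfolding threshold_def by (rule copies_bound_mono) (simp_all add: dimension_def)
  then have "modulator_size + 2 ^ 2 ^ modulator_size * (threshold + 1) * 2 ^ modulator_size
      \<le> kernel_bound modulator_size"
    unfolding kernel_bound_def by (intro add_left_mono mult_le_mono) auto
  with modulator.card_kept_le[of threshold] show ?thesis
    unfolding kept_vertices_def modulator_size_def by linarith
qed

theorem loops_bounded_main:
  assumes "n \<le> W" and exponent: "2 ^ loop_exponent modulator_size \<le> W"
  shows "loops_bounded W xs main_expr []"
proof -
  let ?H = "kernel_bound modulator_size" and ?h = "card kept_vertices"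
  have "2 * ?H \<le> W"
    using kernel_bound_le_loop_exponent less_exp[of "loop_exponent modulator_size"] exponent
    by (metis less_imp_le order_trans)
  moreover have dim: "dimension \<le> modulator_size + 1" by (simp add: dimension_def)
  ultimately have W: "copies_bound modulator_size (modulator_size + 1) \<le> W"
    "dimension \<le> W" "?h + ?h \<le> W"
    using copies_bound_le_kernel_bound[of modulator_size] Suc_le_kernel_bound[of modulator_size]
      card_kept_vertices_le by linarith+
  have "(?h + ?h) * (2 * (?h * dimension)) \<le> loop_exponent modulator_size"
    using card_kept_vertices_le dim Suc_le_kernel_bound[of modulator_size]
    unfolding loop_exponent_def by (intro mult_le_mono) auto
  then have "(2::nat) ^ ((?h + ?h) * (2 * (?h * dimension))) \<le> 2 ^ loop_exponent modulator_size"
    by (rule power_increasing) simp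
  then have "2 ^ ((?h + ?h) * (2 * (?h * dimension))) \<le> W"
    using exponent by (rule order_trans)
  then have "loops_bounded W xs search_expr
      [modulator_mask, threshold, dimension, ?h, ?h + ?h]"
    using assms(1) W by (intro loops_bounded_search arg_cong[OF kept_vertices_def])
  then show ?thesis
    using assms(1) loops_bounded_copies_bound[OF dim W(1)]
    by (simp add: main_expr_def Let_def eval_main_parts
        del: eval_dim eval_copies_bound eval_rank)
qed

corollary main_outputs_within:
  assumes "W = 2 ^ loop_exponent (3 * cluster_vertex_deletion_number (with_proj G)) * max 1 n"
  shows "outputs_within (compile main_expr 0 [] 0) xs (cost W main_expr)
    (if int (boxicity (with_proj G)) \<le> d then 1 else 0)"
proof -
  have "n \<le> W" using mult_le_mono1[of 1 "2 ^ _" "max 1 n"] by (simp add: assms)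
  moreover have "2 ^ loop_exponent modulator_size \<le> W"
  proof -
    have "(2::nat) ^ loop_exponent modulator_size
        \<le> 2 ^ loop_exponent (3 * cluster_vertex_deletion_number (with_proj G))"
      using card_modulator_le unfolding modulator_size_def
      by (intro power_increasing loop_exponent_mono) auto
    also have "\<dots> \<le> W" by (simp add: assms)
    finally show ?thesis .
  qed
  ultimately show ?thesis
    using outputs_within_compile[OF loops_bounded_main] eval_main_eq_boxicity by simp
qed

end

lemma outputs_within_mono: "outputs_within P xs T y \<Longrightarrow> T \<le> T' \<Longrightarrow> outputs_within P xs T' y"
  unfolding outputs_within_def using le_trans by blast

theorem theorem1:
  shows "\<exists>f. computable f \<and>
    (\<exists>(P :: instr list) (c :: nat). \<forall>(G :: nat pair_pre_digraph) (n :: nat) (d :: int).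
      pair_graph G \<and> pverts G = {0..<n} \<longrightarrow>
      outputs_within P (boxicity_instance G d)
        (f (cluster_vertex_deletion_number G) * max 1 n ^ c)
        (if int (boxicity G) \<le> d then 1 else 0))"
proof -
  obtain K D where cost: "\<And>W. W \<ge> 1 \<Longrightarrow> cost W main_expr \<le> K * W ^ D"
    using poly_bounded_cost unfolding poly_bounded_def by blast
  define f where "f k = eval [k] (time_expr K D) []" for k
  have "outputs_within (compile main_expr 0 [] 0) (boxicity_instance G d)
      (f (cluster_vertex_deletion_number G) * max 1 n ^ D) (if int (boxicity G) \<le> d then 1 else 0)"
    if "pair_graph G \<and> pverts G = {0..<n}" for G :: "nat pair_pre_digraph" and n :: nat and d :: int
  proof -
    interpret boxicity_input G n d using that by (simp add: boxicity_input_def)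
    define W where "W = 2 ^ loop_exponent (3 * cluster_vertex_deletion_number G) * max 1 n"
    have "cost W main_expr \<le> K * W ^ D" by (rule cost) (simp add: W_def)
    also have "\<dots> = f (cluster_vertex_deletion_number G) * max 1 n ^ D"
      by (simp add: f_def eval_time W_def power_mult_distrib)
    finally show ?thesis using main_outputs_within[OF W_def] by (rule outputs_within_mono[rotated])
  qed
  moreover have "computable f" unfolding f_def by (rule computable_eval)
  ultimately show ?thesis by blast
qed

end
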